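(* Let $d\ge1$, let $M$ be a loopless matroid of rank $d+1$ on a finite ground set $V$, and let $V_1,\dots,V_m$ be a partition of $V$. If for every $\emptyset\ne I\subset\{1,2,\dots,m\}$ $$\varphi_M^*\Big(\bigcup_{i\in I}V_i\Big)>d\sum_{r=1}^d r\binom{|I|-1}{r},$$ then $V$ contains a colorful subset in general position with respect to $M$, i.e. a set $\sigma\subset V$ in general position with $|\sigma\cap V_i|=1$ for all $i\in\{1,\dots,m\}$.
   Context: Let $\rho$ be the rank function of $M$, so $\rho(V)=d+1$. For $S\subset V$, $\operatorname{cl}(S)=\{v\in V:\rho(S\cup\{v\})=\rho(S)\}$; a flat is a set $F$ with $F=\operatorname{cl}(F)$. A subset $S\subset V$ is in general position with respect to $M$ if for every $1\le k\le d$ every flat of $M$ of rank $k$ contains at most $k$ points of $S$; equivalently (as $M$ is loopless), every $S'\subset S$ with $|S'|\le d+1$ is independent in $M$. For $S\subset V$, a function $f:S\to\mathbb R_{\ge0}$ is in fractional general position with respect to $M$ if for every $1\le k\le d$, every flat $F$ of $M$ of rank $k$ and every $\sigma\subset F\cap S$ of size $k-1$, $$\sum_{v\in S,\ \operatorname{cl}(\{v\}\cup\sigma)=F} f(v)\le d.$$ $\varphi_M^*(S)$ is the maximum of $\sum_{v\in S}f(v)$ over all $f:S\to\mathbb R_{\ge0}$ in fractional general position. *)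

theory Defs
  imports "HOL-Analysis.Analysis"
begin

locale matroid =
  fixes V :: "'a set" and indep :: "'a set \<Rightarrow> bool"
  assumes finite_ground: "finite V"
    and indep_subset_ground: "indep X \<Longrightarrow> X \<subseteq> V"
    and indep_empty: "indep {}"
    and indep_subset: "indep X \<Longrightarrow> Y \<subseteq> X \<Longrightarrow> indep Y"
    and indep_augment:
      "indep X \<Longrightarrow> indep Y \<Longrightarrow> card X < card Y \<Longrightarrow> \<exists>y\<in>Y - X. indep (insert y X)"

definition mat_rank :: "('a set \<Rightarrow> bool) \<Rightarrow> 'a set \<Rightarrow> nat" where
  "mat_rank indep S = Max (card ` {X. X \<subseteq> S \<and> indep X})"

definition loopless :: "'a set \<Rightarrow> ('a set \<Rightarrow> bool) \<Rightarrow> bool" where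
  "loopless V indep \<longleftrightarrow> (\<forall>v\<in>V. indep {v})"

definition mat_cl :: "'a set \<Rightarrow> ('a set \<Rightarrow> bool) \<Rightarrow> 'a set \<Rightarrow> 'a set" where
  "mat_cl V indep S = {v \<in> V. mat_rank indep (S \<union> {v}) = mat_rank indep S}"

definition mat_flat :: "'a set \<Rightarrow> ('a set \<Rightarrow> bool) \<Rightarrow> 'a set \<Rightarrow> bool" where
  "mat_flat V indep F \<longleftrightarrow> F = mat_cl V indep F"

text \<open>In what follows, \<open>d\<close> is one less than the rank of the matroid.\<close>

definition general_position ::
  "'a set \<Rightarrow> ('a set \<Rightarrow> bool) \<Rightarrow> nat \<Rightarrow> 'a set \<Rightarrow> bool" where
  "general_position V indep d S \<longleftrightarrow> S \<subseteq> V \<and>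
     (\<forall>k F. 1 \<le> k \<and> k \<le> d \<and> mat_flat V indep F \<and> mat_rank indep F = k
        \<longrightarrow> card (F \<inter> S) \<le> k)"

text \<open>A function on \<open>S\<close> is represented by a total function whose values outside \<open>S\<close> are ignored.\<close>

definition fractional_general_position ::
  "'a set \<Rightarrow> ('a set \<Rightarrow> bool) \<Rightarrow> nat \<Rightarrow> 'a set \<Rightarrow> ('a \<Rightarrow> real) \<Rightarrow> bool" where
  "fractional_general_position V indep d S f \<longleftrightarrow> (\<forall>v\<in>S. 0 \<le> f v) \<and>
     (\<forall>k F \<sigma>. 1 \<le> k \<and> k \<le> d \<and> mat_flat V indep F \<and> mat_rank indep F = k
          \<and> \<sigma> \<subseteq> F \<inter> S \<and> card \<sigma> = k - 1
        \<longrightarrow> (\<Sum>v | v \<in> S \<and> mat_cl V indep ({v} \<union> \<sigma>) = F. f v) \<le> real d)"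

text \<open>The supremum is a maximum when the matroid is loopless and \<open>d \<ge> 1\<close>; see
  \<open>phi_star_is_maximum\<close> below.\<close>

definition phi_star :: "'a set \<Rightarrow> ('a set \<Rightarrow> bool) \<Rightarrow> nat \<Rightarrow> 'a set \<Rightarrow> real" where
  "phi_star V indep d S =
     Sup {(\<Sum>v\<in>S. f v) | f. fractional_general_position V indep d S f}"

lemma (in matroid) rank_mono:
  assumes "A \<subseteq> B" "B \<subseteq> V"
  shows "mat_rank indep A \<le> mat_rank indep B"
  unfolding mat_rank_def
proof (rule Max_mono)
  have "finite B" using assms finite_ground finite_subset by blast
  then show "finite (card ` {X. X \<subseteq> B \<and> indep X})" by simp
  show "card ` {X. X \<subseteq> A \<and> indep X} \<noteq> {}" using indep_empty by auto
qed (use assms in auto)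

lemma (in matroid) rank_indep:
  assumes "indep X"
  shows "mat_rank indep X = card X"
  unfolding mat_rank_def
proof (rule Max_eqI)
  have fX: "finite X" using assms indep_subset_ground finite_ground finite_subset by blast
  then show "finite (card ` {Y. Y \<subseteq> X \<and> indep Y})" by simp
  show "y \<le> card X" if "y \<in> card ` {Y. Y \<subseteq> X \<and> indep Y}" for y
    using that fX card_mono by auto
  show "card X \<in> card ` {Y. Y \<subseteq> X \<and> indep Y}" using assms by blast
qed

lemma (in matroid) rank_attained:
  assumes "A \<subseteq> V"
  obtains X where "X \<subseteq> A" "indep X" "card X = mat_rank indep A"
proof -
  have "finite A" using assms finite_ground finite_subset by blast
  then have "Max (card ` {X. X \<subseteq> A \<and> indep X}) \<in> card ` {X. X \<subseteq> A \<and> indep X}"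
    using indep_empty by (intro Max_in) auto
  then show thesis using that unfolding mat_rank_def by auto
qed

lemma (in matroid) rank_ge_card:
  assumes "A \<subseteq> V" "X \<subseteq> A" "indep X"
  shows "card X \<le> mat_rank indep A"
  using rank_mono[OF assms(2,1)] rank_indep[OF assms(3)] by simp

lemma (in matroid) cl_singleton:
  assumes "loopless V indep" "v \<in> V"
  shows "v \<in> mat_cl V indep {v}" "mat_flat V indep (mat_cl V indep {v})"
    "mat_rank indep (mat_cl V indep {v}) = 1"
proof -
  let ?F = "mat_cl V indep {v}"
  have iv: "indep {v}" using assms unfolding loopless_def by blast
  have FV: "?F \<subseteq> V" unfolding mat_cl_def by blast
  show vF: "v \<in> ?F" using assms(2) unfolding mat_cl_def by simp
  have rv: "mat_rank indep {v} = 1" using rank_indep[OF iv] by simp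
  have pair: "mat_rank indep {v, w} = 1" if "w \<in> ?F" for w
    using that rv unfolding mat_cl_def by (simp add: insert_commute)
  have bound: "card Y \<le> 1" if Y: "Y \<subseteq> ?F" "indep Y" for Y
  proof (rule ccontr)
    assume "\<not> card Y \<le> 1"
    then have "card {v} < card Y" by simp
    from indep_augment[OF iv Y(2) this] obtain y
      where y: "y \<in> Y" "y \<noteq> v" "indep (insert y {v})" by blast
    have "mat_rank indep {y, v} = 2" using rank_indep[OF y(3)] y(2) by simp
    then show False using pair[of y] y(1) Y(1) by (auto simp: insert_commute)
  qed
  show rF: "mat_rank indep ?F = 1"
  proof (rule antisym)
    show "mat_rank indep ?F \<le> 1" using rank_attained[OF FV] bound by metis
    show "1 \<le> mat_rank indep ?F" using rank_ge_card[OF FV, of "{v}"] vF iv by simp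
  qed
  show "mat_flat V indep ?F" unfolding mat_flat_def
  proof
    show "?F \<subseteq> mat_cl V indep ?F"
      using FV by (auto simp: mat_cl_def[of V indep ?F] insert_absorb)
    show "mat_cl V indep ?F \<subseteq> ?F"
    proof
      fix w assume "w \<in> mat_cl V indep ?F"
      then have w: "w \<in> V" "mat_rank indep (?F \<union> {w}) = 1"
        using rF by (auto simp: mat_cl_def[of V indep ?F])
      have "mat_rank indep ({v} \<union> {w}) \<le> mat_rank indep (?F \<union> {w})"
        using vF FV w(1) by (intro rank_mono) auto
      moreover have "mat_rank indep {v} \<le> mat_rank indep ({v} \<union> {w})"
        using assms(2) w(1) by (intro rank_mono) auto
      ultimately show "w \<in> ?F" using w rv unfolding mat_cl_def by simp
    qed
  qed
qed

lemma (in matroid) phi_star_is_maximum: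
  assumes "loopless V indep" "1 \<le> d" "S \<subseteq> V"
  shows "\<exists>f. fractional_general_position V indep d S f \<and> (\<Sum>v\<in>S. f v) = phi_star V indep d S"
    and "fractional_general_position V indep d S g \<Longrightarrow> (\<Sum>v\<in>S. g v) \<le> phi_star V indep d S"
proof -
  let ?P = "fractional_general_position V indep d S"
  let ?B = "\<lambda>v. if v \<in> S then {0..real d} else {0}"
  have fS: "finite S" using assms finite_ground finite_subset by blast
  have le: "f v \<le> real d" if f: "?P f" and v: "v \<in> S" for f v
  proof -
    let ?F = "mat_cl V indep {v}"
    have vV: "v \<in> V" using v assms(3) by blast
    have "f v \<le> (\<Sum>u | u \<in> S \<and> mat_cl V indep ({u} \<union> {}) = ?F. f u)"
      using f v fS by (intro member_le_sum) (auto simp: fractional_general_position_def)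
    also have "\<dots> \<le> real d"
    proof -
      have "1 \<le> k \<and> k \<le> d \<and> mat_flat V indep F \<and> mat_rank indep F = k
          \<and> \<sigma> \<subseteq> F \<inter> S \<and> card \<sigma> = k - 1
        \<longrightarrow> (\<Sum>v | v \<in> S \<and> mat_cl V indep ({v} \<union> \<sigma>) = F. f v) \<le> real d" for k F \<sigma>
        using f unfolding fractional_general_position_def by blast
      from this[of 1 ?F "{}"] show ?thesis
        using cl_singleton(2,3)[OF assms(1) vV] assms(2) by simp
    qed
    finally show ?thesis .
  qed
  define K where "K = Collect ?P \<inter> PiE UNIV ?B"
  have "compact (PiE UNIV ?B)"
    using compactin_PiE[of "\<lambda>_. euclidean" UNIV ?B]
    by (simp add: euclidean_product_topology)
  moreover have "closed (Collect ?P)"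
    unfolding fractional_general_position_def Ball_def
    by (intro closed_Collect_conj closed_Collect_all closed_Collect_imp open_Collect_const
        closed_Collect_le continuous_intros continuous_on_product_coordinates)
  ultimately have "compact K" unfolding K_def by (intro closed_Int_compact)
  have P0: "?P (\<lambda>_. 0)" by (simp add: fractional_general_position_def)
  then have "K \<noteq> {}" unfolding K_def by fastforce
  have "continuous_on K (\<lambda>f. \<Sum>v\<in>S. f v)"
    by (intro continuous_intros continuous_on_product_coordinates continuous_on_subset[OF _ subset_UNIV])
  from continuous_attains_sup[OF \<open>compact K\<close> \<open>K \<noteq> {}\<close> this]
  obtain h where h: "h \<in> K" "\<And>f. f \<in> K \<Longrightarrow> (\<Sum>v\<in>S. f v) \<le> (\<Sum>v\<in>S. h v)" by blast
  have mx: "(\<Sum>v\<in>S. f v) \<le> (\<Sum>v\<in>S. h v)" if f: "?P f" for f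
  proof -
    define f' where "f' = (\<lambda>v. if v \<in> S then f v else 0)"
    have s: "sum f' A = sum f A" if "A \<subseteq> S" for A
      using that unfolding f'_def by (intro sum.cong) auto
    have "?P f'"
    proof -
      have "(\<Sum>v | v \<in> S \<and> Q v. f' v) = (\<Sum>v | v \<in> S \<and> Q v. f v)" for Q
        by (rule s) auto
      then show ?thesis
        using f unfolding fractional_general_position_def by (simp add: f'_def)
    qed
    then have "f' \<in> K" using le[OF f] f
      by (auto simp: K_def f'_def fractional_general_position_def)
    from h(2)[OF this] show ?thesis by (simp add: s)
  qed
  have "phi_star V indep d S = (\<Sum>v\<in>S. h v)"
    unfolding phi_star_def using h(1) mx by (intro cSup_eq_maximum) (auto simp: K_def)
  then show "\<exists>f. ?P f \<and> (\<Sum>v\<in>S. f v) = phi_star V indep d S"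
    and "?P g \<Longrightarrow> (\<Sum>v\<in>S. g v) \<le> phi_star V indep d S"
    using h(1) mx by (auto simp: K_def)
qed

end

theory Submission
  imports Defs
begin

text \<open>Let \<open>X\<close> be the simplicial complex on \<open>V\<close> whose faces are the sets all of whose subsets of size at
most \<open>d + 1\<close> are independent; a face of \<open>X\<close> is in general position, so a face that meets every
colour class exactly once is wanted. The plan is that of the topological Hall theorem: the
hypothesis forces enough real homology to vanish on each \<open>X\<close> induced on a union of classes, and a
homological version of Sperner's lemma then produces the colourful face.

\<^emph>\<open>Sperner step\<close> (\<open>rainbow_face_exists\<close>). Suppose that for every nonempty set \<open>I\<close> of colours each real
cycle supported on the faces with \<open>card I - 1\<close> vertices and colours in \<open>I\<close> is a boundary of faces with
colours in \<open>I\<close>. By induction on \<open>card I\<close> choose chains \<open>c I\<close> of faces with \<open>card I\<close> vertices so that the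
boundary of \<open>c I\<close> is the alternating sum of the \<open>c (I - {i})\<close>, as for the faces of a simplex. Forgetting
all of a vertex but its colour maps \<open>c I\<close> to a multiple of the simplex on \<open>I\<close>, and comparing boundaries
shows that the multiple is always \<open>1\<close> (\<open>rainbow_boundary\<close>). So \<open>c I\<close> charges some face that carries each
colour of \<open>I\<close> exactly once.

\<^emph>\<open>Vanishing step\<close> (\<open>cycle_bounds_of_fractional\<close>). Let \<open>S\<close> be a union of \<open>n + 1\<close> classes and \<open>f\<close> a weight in
fractional general position on \<open>S\<close> whose sum exceeds \<open>d * (\<Sum>r=1..d. r * (n choose r))\<close>, perturbed so as to be
positive. Projecting a cycle orthogonally onto the boundaries leaves a remainder that is a cycle and is
orthogonal to all boundaries, that is, a harmonic cochain for the inner product given by \<open>f\<close>; it has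
to be shown to be \<open>0\<close>. The Laplacian on the faces with \<open>n\<close> vertices is \<open>sum f S\<close> times the identity minus
the contribution of the pairs \<open>\<tau>\<close>, \<open>v\<close> such that \<open>insert v \<tau>\<close> is not a face. Estimating this contribution by absolute
row sums loses too much already for \<open>d = 1\<close>, where the theorem is Hall's theorem. Instead the part
of it that moves a vertex \<open>u\<close> of \<open>insert u \<rho>\<close> to another vertex \<open>v\<close> is compared with
positive semidefinite forms: if \<open>insert u \<rho>\<close> and \<open>insert v \<rho>\<close> are faces but \<open>insert u (insert v \<rho>)\<close> is not, then some
\<open>\<sigma> \<subseteq> \<rho>\<close> with fewer than \<open>d\<close> elements has \<open>cl (insert u \<sigma>) = cl (insert v \<sigma>)\<close>, and for each \<open>\<sigma>\<close> the
relation given by this equation is an equivalence relation, whose matrix is positive semidefinite. Only the surplus over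
one such \<open>\<sigma>\<close> is estimated by absolute values (\<open>harmonic_vanishes\<close>). What remains is at most the sum of
\<open>f v\<close> over all \<open>u \<in> \<tau>\<close>, all \<open>\<sigma> \<subseteq> \<tau> - {u}\<close> with fewer than \<open>d\<close> elements and all \<open>v\<close> with
\<open>cl (insert v \<sigma>) = cl (insert u \<sigma>)\<close>. Fractional general position bounds each inner sum by \<open>d\<close>, and there are
\<open>\<Sum>r=1..d. r * (n choose r)\<close> pairs \<open>(u, \<sigma>)\<close>, one for each \<open>r\<close>-element subset \<open>insert u \<sigma>\<close> of \<open>\<tau>\<close> with a
marked element \<open>u\<close>. This is less than \<open>sum f S\<close>, so the Laplacian is positive definite.\<close>

section \<open>Oriented chains on a finite complex\<close>

text \<open>The sign of \<open>v\<close> in \<open>insert v \<rho>\<close> when the vertices are listed by increasing \<open>key\<close>.\<close>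
definition orient :: "('a \<Rightarrow> nat) \<Rightarrow> 'a \<Rightarrow> 'a set \<Rightarrow> real" where
  "orient key v \<rho> = (-1) ^ card {w \<in> \<rho>. key w < key v}"

lemma orient_square: "orient key v \<rho> * orient key v \<rho> = 1"
  by (simp add: orient_def flip: power_mult_distrib)

lemma orient_insert:
  assumes "finite \<rho>" "p \<notin> \<rho>"
  shows "orient key v (insert p \<rho>) = (if key p < key v then - orient key v \<rho> else orient key v \<rho>)"
proof -
  have "{w \<in> insert p \<rho>. key w < key v}
      = (if key p < key v then insert p {w \<in> \<rho>. key w < key v} else {w \<in> \<rho>. key w < key v})"
    by auto
  then show ?thesis using assms by (simp add: orient_def)
qed

lemma orient_anticommute:
  assumes "finite \<rho>" "u \<notin> \<rho>" "v \<notin> \<rho>" "key u \<noteq> key v"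
  shows "orient key v \<rho> * orient key u (insert v \<rho>) = - (orient key u \<rho> * orient key v (insert u \<rho>))"
  using assms by (auto simp: orient_insert)

lemma orient_anticommute':
  assumes "finite \<rho>" "u \<notin> \<rho>" "v \<notin> \<rho>" "key u \<noteq> key v"
  shows "orient key v (insert u \<rho>) * orient key u (insert v \<rho>) = - (orient key u \<rho> * orient key v \<rho>)"
  using assms by (auto simp: orient_insert)

text \<open>A chain is given by its coefficients on unordered faces, each oriented by increasing \<open>key\<close>; the boundary
is therefore read off at \<open>\<rho>\<close> from the faces that cover \<open>\<rho>\<close>.\<close>
definition bdry :: "('a \<Rightarrow> nat) \<Rightarrow> 'a set \<Rightarrow> ('a set \<Rightarrow> real) \<Rightarrow> 'a set \<Rightarrow> real" where
  "bdry key S c \<rho> = (\<Sum>v\<in>S - \<rho>. orient key v \<rho> * c (insert v \<rho>))"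

text \<open>The degree counts vertices instead of dimension. Degree \<open>0\<close> is spanned by the empty face, so homology
in this grading is the reduced one.\<close>
definition chain :: "'a set set \<Rightarrow> nat \<Rightarrow> ('a set \<Rightarrow> real) \<Rightarrow> bool" where
  "chain X n c \<longleftrightarrow> (\<forall>\<tau>. c \<tau> \<noteq> 0 \<longrightarrow> \<tau> \<in> X \<and> card \<tau> = n)"

lemma sum_antisym_zero:
  fixes h :: "'a \<Rightarrow> 'a \<Rightarrow> real"
  assumes "\<And>u v. u \<in> S \<Longrightarrow> v \<in> S \<Longrightarrow> u \<noteq> v \<Longrightarrow> h u v = - h v u"
  shows "(\<Sum>u\<in>S. \<Sum>v\<in>S - {u}. h u v) = 0"
proof (cases "finite S")
  case True
  define k where "k u v = (if u = v then 0 else h u v)" for u v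
  have anti: "k u v = - k v u" if "u \<in> S" "v \<in> S" for u v
    using assms[OF that] by (simp add: k_def)
  have "(\<Sum>u\<in>S. \<Sum>v\<in>S - {u}. h u v) = (\<Sum>u\<in>S. \<Sum>v\<in>S. k u v)"
  proof (rule sum.cong[OF refl])
    fix u assume "u \<in> S"
    have "(\<Sum>v\<in>S. k u v) = (\<Sum>v\<in>S - {u}. k u v)"
      using True by (intro sum.mono_neutral_right) (auto simp: k_def)
    also have "\<dots> = (\<Sum>v\<in>S - {u}. h u v)" by (intro sum.cong) (auto simp: k_def)
    finally show "(\<Sum>v\<in>S - {u}. h u v) = (\<Sum>v\<in>S. k u v)" by simp
  qed
  moreover have "(\<Sum>u\<in>S. \<Sum>v\<in>S. k u v) = - (\<Sum>u\<in>S. \<Sum>v\<in>S. k u v)"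
  proof -
    have "(\<Sum>u\<in>S. \<Sum>v\<in>S. k u v) = (\<Sum>v\<in>S. \<Sum>u\<in>S. k u v)" by (rule sum.swap)
    also have "\<dots> = (\<Sum>v\<in>S. \<Sum>u\<in>S. - k v u)" by (intro sum.cong refl anti)
    finally show ?thesis by (simp add: sum_negf)
  qed
  ultimately show ?thesis by linarith
qed simp

lemma bdry_bdry:
  assumes "finite \<rho>" "inj_on key S"
  shows "bdry key S (bdry key S c) \<rho> = 0"
proof -
  have "bdry key S (bdry key S c) \<rho> = (\<Sum>v\<in>S - \<rho>. \<Sum>u\<in>S - \<rho> - {v}.
      orient key v \<rho> * orient key u (insert v \<rho>) * c (insert u (insert v \<rho>)))"
    unfolding bdry_def sum_distrib_left
    by (intro sum.cong) (auto simp: mult.assoc)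
  also have "\<dots> = 0"
  proof (rule sum_antisym_zero)
    fix u v assume *: "u \<in> S - \<rho>" "v \<in> S - \<rho>" "u \<noteq> v"
    then have "key u \<noteq> key v" using assms(2) by (auto dest: inj_onD)
    from orient_anticommute[OF assms(1), of v u key] * this
    show "orient key u \<rho> * orient key v (insert u \<rho>) * c (insert v (insert u \<rho>))
        = - (orient key v \<rho> * orient key u (insert v \<rho>) * c (insert u (insert v \<rho>)))"
      by (simp add: insert_commute)
  qed
  finally show ?thesis .
qed

lemma bdry_chain:
  assumes "chain X (Suc n) c" "finite S" "\<And>\<tau>. \<tau> \<in> X \<Longrightarrow> finite \<tau>"
    and down: "\<And>\<sigma> \<tau>. \<tau> \<in> X \<Longrightarrow> \<sigma> \<subseteq> \<tau> \<Longrightarrow> \<sigma> \<in> X"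
  shows "chain X n (bdry key S c)"
  unfolding chain_def
proof (intro allI impI)
  fix \<rho> assume "bdry key S c \<rho> \<noteq> 0"
  then obtain v where v: "v \<in> S - \<rho>" "c (insert v \<rho>) \<noteq> 0"
    unfolding bdry_def by (metis (no_types, lifting) mult_zero_right sum.neutral)
  then have *: "insert v \<rho> \<in> X" "card (insert v \<rho>) = Suc n" using assms(1) by (auto simp: chain_def)
  moreover have "finite \<rho>" using assms(3)[OF *(1)] by simp
  ultimately show "\<rho> \<in> X \<and> card \<rho> = n" using v(1) down[OF *(1), of \<rho>] by auto
qed

lemma bdry_linear:
  "bdry key S (\<lambda>\<tau>. \<Sum>i\<in>B. a i * c i \<tau>) \<rho> = (\<Sum>i\<in>B. a i * bdry key S (c i) \<rho>)"
proof -
  have "bdry key S (\<lambda>\<tau>. \<Sum>i\<in>B. a i * c i \<tau>) \<rho>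
     = (\<Sum>v\<in>S - \<rho>. \<Sum>i\<in>B. a i * (orient key v \<rho> * c i (insert v \<rho>)))"
    unfolding bdry_def sum_distrib_left by (intro sum.cong refl) (simp add: algebra_simps)
  also have "\<dots> = (\<Sum>i\<in>B. a i * bdry key S (c i) \<rho>)"
    unfolding bdry_def by (subst sum.swap) (simp add: sum_distrib_left)
  finally show ?thesis .
qed

lemma bdry_diff: "bdry key S (\<lambda>\<tau>. c \<tau> - c' \<tau>) \<rho> = bdry key S c \<rho> - bdry key S c' \<rho>"
  by (simp add: bdry_def right_diff_distrib sum_subtractf)

text \<open>Being orthogonal to the boundary of a face \<open>\<kappa>\<close> is the cocycle condition at \<open>\<kappa>\<close>.\<close>
lemma bdry_adjoint:
  assumes "finite S" "finite T" "\<kappa> \<subseteq> S" "\<And>u. u \<in> \<kappa> \<Longrightarrow> \<kappa> - {u} \<in> T"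
  shows "(\<Sum>\<tau>\<in>T. h \<tau> * bdry key S (\<lambda>\<kappa>'. of_bool (\<kappa>' = \<kappa>)) \<tau>)
       = (\<Sum>u\<in>\<kappa>. orient key u (\<kappa> - {u}) * h (\<kappa> - {u}))"
proof -
  let ?A = "Sigma T (\<lambda>\<tau>. S - \<tau>)"
  let ?g = "\<lambda>(\<tau>, v). h \<tau> * (orient key v \<tau> * of_bool (insert v \<tau> = \<kappa>))"
  have "(\<Sum>\<tau>\<in>T. h \<tau> * bdry key S (\<lambda>\<kappa>'. of_bool (\<kappa>' = \<kappa>)) \<tau>) = (\<Sum>p\<in>?A. ?g p)"
    unfolding bdry_def sum_distrib_left using assms(1,2) by (subst sum.Sigma) auto
  also have "\<dots> = (\<Sum>p\<in>(\<lambda>u. (\<kappa> - {u}, u)) ` \<kappa>. ?g p)"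
  proof (rule sum.mono_neutral_right)
    show "\<forall>p\<in>?A - (\<lambda>u. (\<kappa> - {u}, u)) ` \<kappa>. ?g p = 0"
    proof
      fix p assume p: "p \<in> ?A - (\<lambda>u. (\<kappa> - {u}, u)) ` \<kappa>"
      obtain \<tau> v where [simp]: "p = (\<tau>, v)" by fastforce
      have "insert v \<tau> \<noteq> \<kappa>"
      proof
        assume "insert v \<tau> = \<kappa>"
        then have "p = (\<kappa> - {v}, v)" "v \<in> \<kappa>" using p by auto
        then show False using p by blast
      qed
      then show "?g p = 0" by simp
    qed
  qed (use assms in auto)
  also have "\<dots> = (\<Sum>u\<in>\<kappa>. ?g (\<kappa> - {u}, u))"
    by (subst sum.reindex) (auto simp: inj_on_def)
  also have "\<dots> = (\<Sum>u\<in>\<kappa>. orient key u (\<kappa> - {u}) * h (\<kappa> - {u}))"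
    by (intro sum.cong) (auto simp: insert_absorb)
  finally show ?thesis .
qed

section \<open>Orthogonal projection\<close>

text \<open>Gram--Schmidt, one vector at a time: \<open>z\<close> and the new vector \<open>b k\<close> are first made orthogonal to the
old vectors, and then a multiple of the reduced \<open>b k\<close> is subtracted from the reduced \<open>z\<close>. The
\<open>b i\<close> may be linearly dependent.\<close>
lemma weighted_projection:
  fixes b :: "'i \<Rightarrow> 'x \<Rightarrow> real" and z w :: "'x \<Rightarrow> real"
  assumes "finite B" "finite T" "\<And>t. t \<in> T \<Longrightarrow> 0 < w t"
  shows "\<exists>c. \<forall>j\<in>B. (\<Sum>t\<in>T. w t * (z t - (\<Sum>i\<in>B. c i * b i t)) * b j t) = 0"
  using assms(1)
proof (induction B arbitrary: z rule: finite_induct)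
  case empty
  then show ?case by simp
next
  case (insert k B)
  obtain c1 where c1: "\<forall>j\<in>B. (\<Sum>t\<in>T. w t * (z t - (\<Sum>i\<in>B. c1 i * b i t)) * b j t) = 0"
    using insert.IH by blast
  obtain c2 where c2: "\<forall>j\<in>B. (\<Sum>t\<in>T. w t * (b k t - (\<Sum>i\<in>B. c2 i * b i t)) * b j t) = 0"
    using insert.IH by blast
  define z' where "z' t = z t - (\<Sum>i\<in>B. c1 i * b i t)" for t
  define q where "q t = b k t - (\<Sum>i\<in>B. c2 i * b i t)" for t
  define ip where "ip x y = (\<Sum>t\<in>T. w t * x t * y t)" for x y :: "'x \<Rightarrow> real"
  define lam where "lam = ip z' q / ip q q"
  define c where "c = (\<lambda>i. if i = k then lam else c1 i - lam * c2 i)"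
  have ipz: "ip z' (b j) = 0" and ipq: "ip q (b j) = 0" if "j \<in> B" for j
    using c1 c2 that by (auto simp: ip_def z'_def q_def)
  have lin: "ip x (\<lambda>t. \<Sum>i\<in>B. c2 i * b i t) = (\<Sum>i\<in>B. c2 i * ip x (b i))" for x
    unfolding ip_def sum_distrib_left by (subst sum.swap) (simp add: algebra_simps)
  have bk: "ip x (b k) = ip x q + ip x (\<lambda>t. \<Sum>i\<in>B. c2 i * b i t)" for x
    unfolding ip_def sum.distrib[symmetric] by (intro sum.cong) (auto simp: q_def algebra_simps)
  have zk: "ip z' (b k) = ip z' q" and qk: "ip q (b k) = ip q q"
    using ipz ipq by (simp_all add: bk lin)
  \<comment> \<open>If \<open>q\<close> has norm \<open>0\<close> it vanishes on \<open>T\<close>, and the value \<open>lam = 0\<close> given by division by zero is right.\<close>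
  have lam: "ip z' q - lam * ip q q = 0"
  proof (cases "ip q q = 0")
    case True
    have "\<forall>t\<in>T. w t * q t * q t = 0"
      using True assms(2,3) unfolding ip_def
      by (subst (asm) sum_nonneg_eq_0_iff)
         (simp_all add: mult.assoc less_imp_le)
    then have "ip z' q = 0" using assms(3) by (auto simp: ip_def intro!: sum.neutral)
    then show ?thesis using True by simp
  qed (simp add: lam_def)
  have res: "z t - (\<Sum>i\<in>insert k B. c i * b i t) = z' t - lam * q t" for t
  proof -
    have "(\<Sum>i\<in>B. c i * b i t) = (\<Sum>i\<in>B. c1 i * b i t - lam * (c2 i * b i t))"
      using insert.hyps by (intro sum.cong) (auto simp: c_def algebra_simps)
    then show ?thesis
      using insert.hyps
      by (simp add: c_def z'_def q_def sum_subtractf sum_distrib_left algebra_simps)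
  qed
  have "ip (\<lambda>t. z' t - lam * q t) y = ip z' y - lam * ip q y" for y
    by (simp add: ip_def sum_subtractf sum_distrib_left algebra_simps)
  then have "ip (\<lambda>t. z' t - lam * q t) (b j) = 0" if "j \<in> insert k B" for j
    using that ipz ipq zk qk lam by auto
  then show ?case unfolding ip_def res by (intro exI[of _ c]) (simp add: res)
qed

section \<open>Harmonic cochains and a diagonal bound\<close>

text \<open>The form of \<open>K\<close> is that of \<open>Q\<close>, which is nonnegative, minus that of the entrywise nonnegative matrix
\<open>Q - K\<close>; the latter form is at most the one of the diagonal matrix of its row sums, because
\<open>2 * x * y \<le> x\<^sup>2 + y\<^sup>2\<close>.\<close>
lemma offdiagonal_form_bound:
  fixes f G :: "'a \<Rightarrow> real" and Q K :: "'a \<Rightarrow> 'a \<Rightarrow> real"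
  assumes psd: "0 \<le> (\<Sum>u\<in>E. \<Sum>v\<in>E. Q u v * (f u * G u) * (f v * G v))"
    and le: "\<And>u v. u \<in> E \<Longrightarrow> v \<in> E \<Longrightarrow> K u v \<le> Q u v"
    and sym: "\<And>u v. u \<in> E \<Longrightarrow> v \<in> E \<Longrightarrow> Q u v - K u v = Q v u - K v u"
    and f: "\<And>u. u \<in> E \<Longrightarrow> 0 \<le> f u"
  shows "- (\<Sum>u\<in>E. f u * (G u)^2 * (\<Sum>v\<in>E. (Q u v - K u v) * f v))
      \<le> (\<Sum>u\<in>E. \<Sum>v\<in>E. K u v * (f u * G u) * (f v * G v))"
proof -
  define D where "D u v = (Q u v - K u v) * f u * f v" for u v
  have D: "0 \<le> D u v" "D u v = D v u" if "u \<in> E" "v \<in> E" for u v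
    using that le f sym by (auto simp: D_def)
  have "(\<Sum>u\<in>E. \<Sum>v\<in>E. D u v * G u * G v)
      \<le> (\<Sum>u\<in>E. \<Sum>v\<in>E. (D u v * (G u)^2 + D v u * (G v)^2) / 2)"
  proof (intro sum_mono)
    fix u v assume uv: "u \<in> E" "v \<in> E"
    have "G u * G v \<le> ((G u)^2 + (G v)^2) / 2"
      using sum_squares_bound[of "G u" "G v"] by simp
    then have "D u v * (G u * G v) \<le> D u v * (((G u)^2 + (G v)^2) / 2)"
      using D(1)[OF uv] by (rule mult_left_mono)
    then show "D u v * G u * G v \<le> (D u v * (G u)^2 + D v u * (G v)^2) / 2"
      using D(2)[OF uv] by (simp add: algebra_simps)
  qed
  also have "\<dots> = ((\<Sum>u\<in>E. \<Sum>v\<in>E. D u v * (G u)^2) + (\<Sum>u\<in>E. \<Sum>v\<in>E. D v u * (G v)^2)) / 2"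
    by (simp add: sum.distrib add_divide_distrib sum_divide_distrib)
  also have "(\<Sum>u\<in>E. \<Sum>v\<in>E. D v u * (G v)^2) = (\<Sum>u\<in>E. \<Sum>v\<in>E. D u v * (G u)^2)"
    by (rule sum.swap)
  finally have "(\<Sum>u\<in>E. \<Sum>v\<in>E. D u v * G u * G v) \<le> (\<Sum>u\<in>E. \<Sum>v\<in>E. D u v * (G u)^2)" by simp
  also have "\<dots> = (\<Sum>u\<in>E. f u * (G u)^2 * (\<Sum>v\<in>E. (Q u v - K u v) * f v))"
    by (simp add: D_def sum_distrib_left algebra_simps)
  finally show ?thesis
    using psd by (simp add: D_def algebra_simps sum_subtractf)
qed

locale ordered_complex =
  fixes S :: "'a set" and X :: "'a set set" and key :: "'a \<Rightarrow> nat"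
  assumes fin: "finite S" and ground: "\<And>\<tau>. \<tau> \<in> X \<Longrightarrow> \<tau> \<subseteq> S"
    and down: "\<And>\<sigma> \<tau>. \<tau> \<in> X \<Longrightarrow> \<sigma> \<subseteq> \<tau> \<Longrightarrow> \<sigma> \<in> X"
    and inj: "inj_on key S"
begin

lemma fin_X: "finite X"
  using fin ground by (meson PowI finite_Pow_iff finite_subset subsetI)

lemma fin_face: "\<tau> \<in> X \<Longrightarrow> finite \<tau>"
  using fin ground finite_subset by blast

definition ext :: "'a set \<Rightarrow> 'a set" where
  "ext \<tau> = {v \<in> S - \<tau>. insert v \<tau> \<in> X}"

definition nonext :: "'a set \<Rightarrow> 'a set" where
  "nonext \<tau> = {v \<in> S - \<tau>. insert v \<tau> \<notin> X}"

text \<open>The pairs of vertices through which the Laplacian acts between \<open>insert u \<rho>\<close> and \<open>insert v \<rho>\<close>: when \<open>insert u (insert v \<rho>)\<close>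
is a face, the contributions of the lower and of the upper neighbourhood cancel.\<close>
definition clash :: "'a set \<Rightarrow> 'a \<Rightarrow> 'a \<Rightarrow> real" where
  "clash \<rho> u v = of_bool (u \<noteq> v \<and> insert u (insert v \<rho>) \<notin> X)"

lemma split_ground:
  assumes "\<tau> \<in> X"
  shows "S = \<tau> \<union> (nonext \<tau> \<union> ext \<tau>)" "\<tau> \<inter> (nonext \<tau> \<union> ext \<tau>) = {}" "nonext \<tau> \<inter> ext \<tau> = {}"
    "finite (nonext \<tau>)" "finite (ext \<tau>)"
  using ground[OF assms] fin by (auto simp: ext_def nonext_def)

text \<open>The Laplacian of a harmonic \<open>g\<close>, evaluated at the face \<open>\<tau>\<close>. For \<open>v \<in> ext \<tau>\<close> the cocycle condition at \<open>insert v \<tau>\<close>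
expresses \<open>g \<tau>\<close> by the values on the faces \<open>insert v (\<tau> - {u})\<close>; averaging this over \<open>v\<close> with weights \<open>f\<close>
and removing the sums over \<open>ext \<tau>\<close> by the cycle condition at \<open>\<tau> - {u}\<close> leaves only terms with
\<open>v \<in> nonext \<tau>\<close>.\<close>
lemma harmonic_pointwise:
  fixes f :: "'a \<Rightarrow> real" and g :: "'a set \<Rightarrow> real"
  assumes cocycle: "\<And>\<kappa>. \<kappa> \<in> X \<Longrightarrow> card \<kappa> = Suc n \<Longrightarrow>
          (\<Sum>u\<in>\<kappa>. orient key u (\<kappa> - {u}) * g (\<kappa> - {u})) = 0"
    and cyc: "\<And>\<rho>. \<rho> \<in> X \<Longrightarrow> Suc (card \<rho>) = n \<Longrightarrow>
          (\<Sum>v\<in>S - \<rho>. f v * (orient key v \<rho> * g (insert v \<rho>))) = 0"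
    and \<tau>: "\<tau> \<in> X" "card \<tau> = n"
  shows "(sum f S - sum f (nonext \<tau>)) * g \<tau> + (\<Sum>u\<in>\<tau>. orient key u (\<tau> - {u}) *
      (\<Sum>v\<in>nonext \<tau>. f v * (orient key v (\<tau> - {u}) * g (insert v (\<tau> - {u}))))) = 0"
proof -
  define G where "G \<rho> v = orient key v \<rho> * g (insert v \<rho>)" for \<rho> v
  let ?s = "\<lambda>u. orient key u (\<tau> - {u})"
  have ft: "finite \<tau>" using fin_face \<tau> by blast
  have sG: "?s u * G (\<tau> - {u}) u = g \<tau>" if "u \<in> \<tau>" for u
    using that orient_square[of key u "\<tau> - {u}"] by (simp add: G_def insert_absorb)
  have extend: "g \<tau> = (\<Sum>u\<in>\<tau>. ?s u * G (\<tau> - {u}) v)" if v: "v \<in> ext \<tau>" for v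
  proof -
    have v': "v \<notin> \<tau>" "insert v \<tau> \<in> X" "v \<in> S" using v by (auto simp: ext_def)
    let ?o = "orient key v \<tau>"
    have "0 = (\<Sum>u\<in>insert v \<tau>. orient key u (insert v \<tau> - {u}) * g (insert v \<tau> - {u}))"
      using cocycle[OF v'(2)] v' ft \<tau> by simp
    also have "\<dots> = ?o * g \<tau> + (\<Sum>u\<in>\<tau>. orient key u (insert v \<tau> - {u}) * g (insert v \<tau> - {u}))"
      using v' ft by (simp add: insert_Diff_if)
    finally have "?o * g \<tau> = - (\<Sum>u\<in>\<tau>. orient key u (insert v \<tau> - {u}) * g (insert v \<tau> - {u}))"
      by simp
    then have "?o * (?o * g \<tau>) = - ?o * (\<Sum>u\<in>\<tau>. orient key u (insert v \<tau> - {u}) * g (insert v \<tau> - {u}))"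
      by simp
    also have "\<dots> = (\<Sum>u\<in>\<tau>. ?s u * G (\<tau> - {u}) v)"
      unfolding sum_distrib_left
    proof (rule sum.cong[OF refl])
      fix u assume u: "u \<in> \<tau>"
      have "insert v \<tau> - {u} = insert v (\<tau> - {u})" "insert u (\<tau> - {u}) = \<tau>"
        using u v' by auto
      moreover have "key u \<noteq> key v"
        using u v' ground[OF \<tau>(1)] inj by (auto dest: inj_onD)
      ultimately show "- ?o * (orient key u (insert v \<tau> - {u}) * g (insert v \<tau> - {u}))
          = ?s u * G (\<tau> - {u}) v"
        using orient_anticommute'[of "\<tau> - {u}" u v key] v' ft by (simp add: G_def flip: mult.assoc)
    qed
    finally show ?thesis
      using orient_square[of key v \<tau>] by (simp flip: mult.assoc)
  qed
  have cycle: "(\<Sum>v\<in>ext \<tau>. f v * G (\<tau> - {u}) v)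
      = - f u * G (\<tau> - {u}) u - (\<Sum>v\<in>nonext \<tau>. f v * G (\<tau> - {u}) v)" if u: "u \<in> \<tau>" for u
  proof -
    have "card \<tau> \<noteq> 0" using u ft by auto
    then have "Suc (card (\<tau> - {u})) = n" using u ft \<tau> by simp
    moreover have "\<tau> - {u} \<in> X" by (rule down[OF \<tau>(1)]) auto
    ultimately have "0 = (\<Sum>v\<in>S - (\<tau> - {u}). f v * G (\<tau> - {u}) v)"
      unfolding G_def using cyc by simp
    also have "S - (\<tau> - {u}) = insert u (nonext \<tau> \<union> ext \<tau>)"
      using split_ground[OF \<tau>(1)] u by blast
    also have "(\<Sum>v\<in>\<dots>. f v * G (\<tau> - {u}) v) = f u * G (\<tau> - {u}) u
        + ((\<Sum>v\<in>nonext \<tau>. f v * G (\<tau> - {u}) v) + (\<Sum>v\<in>ext \<tau>. f v * G (\<tau> - {u}) v))"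
      using split_ground[OF \<tau>(1)] u
      by (subst sum.insert) (auto simp: sum.union_disjoint)
    finally show ?thesis by simp
  qed
  have "sum f S = sum f \<tau> + (sum f (nonext \<tau>) + sum f (ext \<tau>))"
    using split_ground[OF \<tau>(1)] ft by (metis sum.union_disjoint finite_Un)
  moreover have "sum f (ext \<tau>) * g \<tau> = (\<Sum>u\<in>\<tau>. ?s u * (\<Sum>v\<in>ext \<tau>. f v * G (\<tau> - {u}) v))"
  proof -
    have "sum f (ext \<tau>) * g \<tau> = (\<Sum>v\<in>ext \<tau>. \<Sum>u\<in>\<tau>. ?s u * (f v * G (\<tau> - {u}) v))"
      unfolding sum_distrib_right
      by (intro sum.cong refl, subst extend) (auto simp: sum_distrib_left algebra_simps)
    then show ?thesis by (subst (asm) sum.swap) (simp add: sum_distrib_left)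
  qed
  moreover have "\<dots> = - sum f \<tau> * g \<tau> - (\<Sum>u\<in>\<tau>. ?s u * (\<Sum>v\<in>nonext \<tau>. f v * G (\<tau> - {u}) v))"
  proof -
    have "?s u * (\<Sum>v\<in>ext \<tau>. f v * G (\<tau> - {u}) v)
        = - (f u * g \<tau>) - ?s u * (\<Sum>v\<in>nonext \<tau>. f v * G (\<tau> - {u}) v)" if "u \<in> \<tau>" for u
      unfolding cycle[OF that] sG[OF that, symmetric] by (simp add: algebra_simps)
    then show ?thesis
      by (simp add: sum_subtractf sum_negf sum_distrib_right)
  qed
  ultimately show ?thesis unfolding G_def by (simp add: algebra_simps)
qed

text \<open>Multiply the pointwise identity by \<open>prod f \<tau> * g \<tau>\<close> and sum over the faces \<open>\<tau>\<close> with \<open>n\<close> vertices. The mixed terms,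
grouped by the common subface \<open>\<rho> = \<tau> - {u}\<close>, form the quadratic form of \<open>clash \<rho>\<close>, to which
\<open>offdiagonal_form_bound\<close> applies. The outcome is a nonpositive sum of terms \<open>prod f \<tau> * (g \<tau>)\<^sup>2\<close> whose coefficients are
positive by the assumption \<open>bound\<close>.\<close>
lemma harmonic_vanishes:
  fixes f :: "'a \<Rightarrow> real" and g :: "'a set \<Rightarrow> real" and Q :: "'a set \<Rightarrow> 'a \<Rightarrow> 'a \<Rightarrow> real"
  assumes pos: "\<And>v. v \<in> S \<Longrightarrow> 0 < f v"
    and ch: "chain X n g"
    and cocycle: "\<And>\<kappa>. \<kappa> \<in> X \<Longrightarrow> card \<kappa> = Suc n \<Longrightarrow>
          (\<Sum>u\<in>\<kappa>. orient key u (\<kappa> - {u}) * g (\<kappa> - {u})) = 0"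
    and cyc: "\<And>\<rho>. \<rho> \<in> X \<Longrightarrow> Suc (card \<rho>) = n \<Longrightarrow>
          (\<Sum>v\<in>S - \<rho>. f v * (orient key v \<rho> * g (insert v \<rho>))) = 0"
    and psd: "\<And>\<rho> a. \<rho> \<in> X \<Longrightarrow> 0 \<le> (\<Sum>u\<in>ext \<rho>. \<Sum>v\<in>ext \<rho>. Q \<rho> u v * a u * a v)"
    and sym: "\<And>\<rho> u v. Q \<rho> u v = Q \<rho> v u"
    and ge: "\<And>\<rho> u v. \<rho> \<in> X \<Longrightarrow> u \<in> ext \<rho> \<Longrightarrow> v \<in> ext \<rho> \<Longrightarrow> clash \<rho> u v \<le> Q \<rho> u v"
    and bound: "\<And>\<tau>. \<tau> \<in> X \<Longrightarrow> card \<tau> = n \<Longrightarrow> sum f (nonext \<tau>) +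
        (\<Sum>u\<in>\<tau>. \<Sum>v\<in>ext (\<tau> - {u}). (Q (\<tau> - {u}) u v - clash (\<tau> - {u}) u v) * f v) < sum f S"
  shows "g \<tau> = 0"
proof -
  define XN where "XN = {\<tau> \<in> X. card \<tau> = n}"
  define XM where "XM = {\<rho> \<in> X. Suc (card \<rho>) = n}"
  define w where "w \<tau> = prod f \<tau>" for \<tau>
  define G where "G \<rho> v = orient key v \<rho> * g (insert v \<rho>)" for \<rho> v
  define C where "C \<rho> u = (\<Sum>v\<in>ext \<rho>. (Q \<rho> u v - clash \<rho> u v) * f v)" for \<rho> u
  define H where "H \<rho> u = (\<Sum>v\<in>ext \<rho>. clash \<rho> u v * (f u * G \<rho> u) * (f v * G \<rho> v))" for \<rho> u
  have fXN: "finite XN" and fXM: "finite XM" using fin_X by (auto simp: XN_def XM_def)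
  have fext: "finite (ext \<rho>)" for \<rho> using fin by (auto simp: ext_def)
  have wpos: "0 < w \<tau>" if "\<tau> \<in> X" for \<tau>
    using that ground pos unfolding w_def by (intro prod_pos) blast
  \<comment> \<open>A face with a marked vertex is the same as a subface together with a vertex extending it.\<close>
  have flags: "(\<Sum>\<tau>\<in>XN. \<Sum>u\<in>\<tau>. k (\<tau> - {u}) u) = (\<Sum>\<rho>\<in>XM. \<Sum>u\<in>ext \<rho>. k \<rho> u)"
    for k :: "'a set \<Rightarrow> 'a \<Rightarrow> real"
  proof -
    have "(\<Sum>\<tau>\<in>XN. \<Sum>u\<in>\<tau>. k (\<tau> - {u}) u) = (\<Sum>(\<tau>,u)\<in>Sigma XN (\<lambda>\<tau>. \<tau>). k (\<tau> - {u}) u)"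
      using fXN fin_face by (subst sum.Sigma) (auto simp: XN_def)
    also have "\<dots> = (\<Sum>(\<rho>,u)\<in>Sigma XM ext. k \<rho> u)"
    proof (rule sum.reindex_bij_witness[where i="\<lambda>(\<rho>,u). (insert u \<rho>, u)" and j="\<lambda>(\<tau>,u). (\<tau> - {u}, u)"])
      fix p assume "p \<in> Sigma XN (\<lambda>\<tau>. \<tau>)"
      then obtain \<tau> u where p: "p = (\<tau>, u)" "\<tau> \<in> X" "card \<tau> = n" "u \<in> \<tau>" by (auto simp: XN_def)
      then have "Suc (card (\<tau> - {u})) = n" using fin_face[of \<tau>] by (metis card_Suc_Diff1)
      moreover have "\<tau> - {u} \<in> X" by (rule down[OF p(2)]) auto
      ultimately show "(case p of (\<tau>, u) \<Rightarrow> (\<tau> - {u}, u)) \<in> Sigma XM ext"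
        using p ground[OF p(2)] by (auto simp: XM_def ext_def insert_absorb)
    next
      fix p assume "p \<in> Sigma XM ext"
      then show "(case p of (\<rho>, u) \<Rightarrow> (insert u \<rho>, u)) \<in> Sigma XN (\<lambda>\<tau>. \<tau>)"
        using fin_face by (auto simp: XM_def XN_def ext_def)
    qed (auto simp: ext_def)
    also have "\<dots> = (\<Sum>\<rho>\<in>XM. \<Sum>u\<in>ext \<rho>. k \<rho> u)"
      using fXM fext by (subst sum.Sigma) auto
    finally show ?thesis .
  qed
  have clash_sum: "G \<rho> u * f u * (\<Sum>v\<in>nonext (insert u \<rho>). f v * G \<rho> v) = H \<rho> u"
    if "\<rho> \<in> X" "u \<in> ext \<rho>" for \<rho> u
  proof -
    have G0: "G \<rho> v = 0" if "v \<in> S - \<rho>" "v \<notin> ext \<rho>" for v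
      using that ch by (auto simp: G_def ext_def chain_def)
    have "(\<Sum>v\<in>nonext (insert u \<rho>). f v * G \<rho> v) = (\<Sum>v\<in>nonext (insert u \<rho>) \<inter> ext \<rho>. f v * G \<rho> v)"
      using fin G0 by (intro sum.mono_neutral_right) (auto simp: nonext_def)
    also have "\<dots> = (\<Sum>v\<in>ext \<rho>. clash \<rho> u v * (f v * G \<rho> v))"
      using fext that
      by (intro sum.mono_neutral_cong_left)
         (auto simp: clash_def nonext_def ext_def insert_commute)
    finally show ?thesis by (simp add: H_def sum_distrib_left algebra_simps)
  qed
  have "0 = (\<Sum>\<tau>\<in>XN. w \<tau> * g \<tau> * ((sum f S - sum f (nonext \<tau>)) * g \<tau> + (\<Sum>u\<in>\<tau>. orient key u (\<tau> - {u}) *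
      (\<Sum>v\<in>nonext \<tau>. f v * G (\<tau> - {u}) v))))"
    unfolding G_def using harmonic_pointwise[OF cocycle cyc] by (simp add: XN_def)
  also have "\<dots> = (\<Sum>\<tau>\<in>XN. w \<tau> * (g \<tau>)^2 * (sum f S - sum f (nonext \<tau>)))
      + (\<Sum>\<tau>\<in>XN. \<Sum>u\<in>\<tau>. w (\<tau> - {u}) * H (\<tau> - {u}) u)"
    unfolding sum.distrib[symmetric]
  proof (rule sum.cong[OF refl])
    fix \<tau> assume "\<tau> \<in> XN"
    then have \<tau>: "\<tau> \<in> X" "finite \<tau>" using fin_face by (auto simp: XN_def)
    have "w \<tau> * g \<tau> * (orient key u (\<tau> - {u}) * (\<Sum>v\<in>nonext \<tau>. f v * G (\<tau> - {u}) v))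
        = w (\<tau> - {u}) * H (\<tau> - {u}) u" if u: "u \<in> \<tau>" for u
    proof -
      have i: "insert u (\<tau> - {u}) = \<tau>" using u by auto
      have "\<tau> - {u} \<in> X" by (rule down[OF \<tau>(1)]) auto
      moreover have "u \<in> ext (\<tau> - {u})" using u \<tau> ground i by (auto simp: ext_def)
      ultimately have H: "G (\<tau> - {u}) u * f u * (\<Sum>v\<in>nonext \<tau>. f v * G (\<tau> - {u}) v) = H (\<tau> - {u}) u"
        using clash_sum[of "\<tau> - {u}" u] unfolding i by blast
      have "w \<tau> = w (\<tau> - {u}) * f u"
        unfolding w_def using u \<tau> by (simp add: prod.remove mult.commute)
      moreover have "G (\<tau> - {u}) u = g \<tau> * orient key u (\<tau> - {u})"
        unfolding G_def i by simp
      ultimately show ?thesis by (simp flip: H add: algebra_simps)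
    qed
    then show "w \<tau> * g \<tau> * ((sum f S - sum f (nonext \<tau>)) * g \<tau> + (\<Sum>u\<in>\<tau>. orient key u (\<tau> - {u}) *
      (\<Sum>v\<in>nonext \<tau>. f v * G (\<tau> - {u}) v))) = w \<tau> * (g \<tau>)^2 * (sum f S - sum f (nonext \<tau>))
      + (\<Sum>u\<in>\<tau>. w (\<tau> - {u}) * H (\<tau> - {u}) u)"
      by (simp add: distrib_left sum_distrib_left power2_eq_square algebra_simps)
  qed
  also have "(\<Sum>\<tau>\<in>XN. \<Sum>u\<in>\<tau>. w (\<tau> - {u}) * H (\<tau> - {u}) u) = (\<Sum>\<rho>\<in>XM. w \<rho> * (\<Sum>u\<in>ext \<rho>. H \<rho> u))"
    by (subst flags) (simp add: sum_distrib_left)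
  finally have energy: "0 = (\<Sum>\<tau>\<in>XN. w \<tau> * (g \<tau>)^2 * (sum f S - sum f (nonext \<tau>)))
      + (\<Sum>\<rho>\<in>XM. w \<rho> * (\<Sum>u\<in>ext \<rho>. H \<rho> u))" .
  have lower: "(\<Sum>\<rho>\<in>XM. w \<rho> * (\<Sum>u\<in>ext \<rho>. H \<rho> u)) \<ge> (\<Sum>\<rho>\<in>XM. w \<rho> * - (\<Sum>u\<in>ext \<rho>. f u * (G \<rho> u)^2 * C \<rho> u))"
  proof (intro sum_mono mult_left_mono)
    fix \<rho> assume \<rho>: "\<rho> \<in> XM"
    then show "0 \<le> w \<rho>" using wpos by (force simp: XM_def)
    show "- (\<Sum>u\<in>ext \<rho>. f u * (G \<rho> u)^2 * C \<rho> u) \<le> (\<Sum>u\<in>ext \<rho>. H \<rho> u)"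
      unfolding C_def H_def
    proof (rule offdiagonal_form_bound)
      show "Q \<rho> u v - clash \<rho> u v = Q \<rho> v u - clash \<rho> v u" for u v
        using sym[of \<rho> u v] by (auto simp: clash_def insert_commute)
    qed (use \<rho> psd ge pos in \<open>auto simp: XM_def ext_def less_imp_le\<close>)
  qed
  have "(\<Sum>\<rho>\<in>XM. w \<rho> * - (\<Sum>u\<in>ext \<rho>. f u * (G \<rho> u)^2 * C \<rho> u))
      = - (\<Sum>\<rho>\<in>XM. \<Sum>u\<in>ext \<rho>. w \<rho> * f u * (G \<rho> u)^2 * C \<rho> u)"
    by (simp add: sum_distrib_left sum_negf mult.assoc)
  also have "\<dots> = - (\<Sum>\<tau>\<in>XN. \<Sum>u\<in>\<tau>. w (\<tau> - {u}) * f u * (G (\<tau> - {u}) u)^2 * C (\<tau> - {u}) u)"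
    by (subst flags) simp
  also have "\<dots> = - (\<Sum>\<tau>\<in>XN. w \<tau> * (g \<tau>)^2 * (\<Sum>u\<in>\<tau>. C (\<tau> - {u}) u))"
  proof -
    have "w (\<tau> - {u}) * f u * (G (\<tau> - {u}) u)^2 = w \<tau> * (g \<tau>)^2" if "\<tau> \<in> XN" "u \<in> \<tau>" for \<tau> u
    proof -
      have "insert u (\<tau> - {u}) = \<tau>" "finite \<tau>" using that fin_face by (auto simp: XN_def)
      moreover from this have "w \<tau> = w (\<tau> - {u}) * f u"
        unfolding w_def using that by (simp add: prod.remove mult.commute)
      ultimately show ?thesis
        using orient_square[of key u "\<tau> - {u}"]
        by (simp add: G_def power_mult_distrib power2_eq_square)
    qed
    then show ?thesis by (simp add: sum_distrib_left)
  qed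
  finally have "(\<Sum>\<tau>\<in>XN. w \<tau> * (g \<tau>)^2 * (sum f S - sum f (nonext \<tau>)))
      + - (\<Sum>\<tau>\<in>XN. w \<tau> * (g \<tau>)^2 * (\<Sum>u\<in>\<tau>. C (\<tau> - {u}) u)) \<le> 0"
    using energy lower by linarith
  then have "(\<Sum>\<tau>\<in>XN. w \<tau> * (g \<tau>)^2 * (sum f S - sum f (nonext \<tau>) - (\<Sum>u\<in>\<tau>. C (\<tau> - {u}) u))) \<le> 0"
    by (simp add: right_diff_distrib sum_subtractf)
  moreover have gap: "0 < sum f S - sum f (nonext \<tau>) - (\<Sum>u\<in>\<tau>. C (\<tau> - {u}) u)" if "\<tau> \<in> XN" for \<tau>
    using bound[of \<tau>] that by (simp add: XN_def C_def)
  moreover have nn: "0 \<le> w \<tau> * (g \<tau>)^2 * (sum f S - sum f (nonext \<tau>) - (\<Sum>u\<in>\<tau>. C (\<tau> - {u}) u))"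
    if "\<tau> \<in> XN" for \<tau>
    using gap[OF that] wpos that by (intro mult_nonneg_nonneg) (auto simp: XN_def less_imp_le)
  ultimately have "(\<Sum>\<tau>\<in>XN. w \<tau> * (g \<tau>)^2 * (sum f S - sum f (nonext \<tau>) - (\<Sum>u\<in>\<tau>. C (\<tau> - {u}) u))) = 0"
    by (intro antisym sum_nonneg) auto
  then have all0: "\<forall>\<tau>\<in>XN. w \<tau> * (g \<tau>)^2 * (sum f S - sum f (nonext \<tau>) - (\<Sum>u\<in>\<tau>. C (\<tau> - {u}) u)) = 0"
    using fXN nn by (subst (asm) sum_nonneg_eq_0_iff) auto
  show "g \<tau> = 0"
  proof (cases "\<tau> \<in> XN")
    case True
    then show ?thesis using all0 gap[OF True] wpos[of \<tau>] by (fastforce simp: XN_def)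
  next
    case False
    then show ?thesis using ch by (auto simp: chain_def XN_def)
  qed
qed

text \<open>The remainder \<open>x\<close> of \<open>z\<close> after projection to the boundaries vanishes because \<open>\<tau> \<mapsto> x \<tau> / prod f \<tau>\<close> is harmonic:
with respect to the weights \<open>1 / prod f\<close> orthogonality to boundaries is the cocycle condition for this quotient, and
\<open>prod f (insert v \<rho>) = f v * prod f \<rho>\<close> turns the cycle condition for \<open>x\<close> into the weighted one.\<close>
lemma cycle_bounds:
  fixes f :: "'a \<Rightarrow> real" and z :: "'a set \<Rightarrow> real" and Q :: "'a set \<Rightarrow> 'a \<Rightarrow> 'a \<Rightarrow> real"
  assumes pos: "\<And>v. v \<in> S \<Longrightarrow> 0 < f v"
    and psd: "\<And>\<rho> a. \<rho> \<in> X \<Longrightarrow> 0 \<le> (\<Sum>u\<in>ext \<rho>. \<Sum>v\<in>ext \<rho>. Q \<rho> u v * a u * a v)"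
    and sym: "\<And>\<rho> u v. Q \<rho> u v = Q \<rho> v u"
    and ge: "\<And>\<rho> u v. \<rho> \<in> X \<Longrightarrow> u \<in> ext \<rho> \<Longrightarrow> v \<in> ext \<rho> \<Longrightarrow> clash \<rho> u v \<le> Q \<rho> u v"
    and bound: "\<And>\<tau>. \<tau> \<in> X \<Longrightarrow> card \<tau> = n \<Longrightarrow> sum f (nonext \<tau>) +
        (\<Sum>u\<in>\<tau>. \<Sum>v\<in>ext (\<tau> - {u}). (Q (\<tau> - {u}) u v - clash (\<tau> - {u}) u v) * f v) < sum f S"
    and z: "chain X n z" "\<And>\<rho>. bdry key S z \<rho> = 0"
  shows "\<exists>y. chain X (Suc n) y \<and> bdry key S y = z"
proof -
  define T where "T = {\<tau> \<in> X. card \<tau> = n}"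
  define B where "B = {\<kappa> \<in> X. card \<kappa> = Suc n}"
  define w where "w \<tau> = prod f \<tau>" for \<tau>
  define b where "b \<kappa> = bdry key S (\<lambda>\<kappa>'. of_bool (\<kappa>' = \<kappa>))" for \<kappa>
  have wpos: "0 < w \<tau>" if "\<tau> \<in> X" for \<tau>
    using that ground pos unfolding w_def by (intro prod_pos) blast
  have fT: "finite T" and fB: "finite B" using fin_X by (auto simp: T_def B_def)
  obtain c where c: "\<forall>\<kappa>\<in>B. (\<Sum>\<tau>\<in>T. inverse (w \<tau>) * (z \<tau> - (\<Sum>i\<in>B. c i * b i \<tau>)) * b \<kappa> \<tau>) = 0"
    using weighted_projection[OF fB fT, of "\<lambda>\<tau>. inverse (w \<tau>)" z b] wpos
    by (auto simp: T_def)
  define y where "y \<tau> = (\<Sum>i\<in>B. c i * of_bool (\<tau> = i))" for \<tau>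
  have y: "chain X (Suc n) y"
    unfolding chain_def
  proof (intro allI impI)
    fix \<tau> assume "y \<tau> \<noteq> 0"
    then obtain i where "i \<in> B" "c i * of_bool (\<tau> = i) \<noteq> 0" unfolding y_def
      by (meson sum.neutral)
    then show "\<tau> \<in> X \<and> card \<tau> = Suc n" by (auto simp: B_def)
  qed
  have by_eq: "bdry key S y \<tau> = (\<Sum>i\<in>B. c i * b i \<tau>)" for \<tau>
    unfolding y_def[abs_def] b_def by (rule bdry_linear)
  define x where "x \<tau> = z \<tau> - bdry key S y \<tau>" for \<tau>
  define g where "g \<tau> = inverse (w \<tau>) * x \<tau>" for \<tau>
  have "chain X n (bdry key S y)" by (rule bdry_chain[OF y fin fin_face down])
  then have x: "chain X n x"
    using z(1) unfolding chain_def x_def by (metis diff_self)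
  then have g: "chain X n g" by (auto simp: chain_def g_def)
  have g0: "g \<tau> = 0" for \<tau>
  proof (rule harmonic_vanishes[where f=f and Q=Q, OF pos g _ _ psd sym ge bound])
    fix \<kappa> assume \<kappa>: "\<kappa> \<in> X" "card \<kappa> = Suc n"
    have "(\<Sum>u\<in>\<kappa>. orient key u (\<kappa> - {u}) * g (\<kappa> - {u})) = (\<Sum>\<tau>\<in>T. g \<tau> * b \<kappa> \<tau>)"
      unfolding b_def
    proof (rule bdry_adjoint[symmetric, OF fin fT ground[OF \<kappa>(1)]])
      fix u assume "u \<in> \<kappa>"
      then show "\<kappa> - {u} \<in> T" using \<kappa> fin_face[OF \<kappa>(1)] down[OF \<kappa>(1), of "\<kappa> - {u}"] by (auto simp: T_def)
    qed
    also have "\<dots> = 0" using c \<kappa> by (simp add: B_def g_def x_def by_eq)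
    finally show "(\<Sum>u\<in>\<kappa>. orient key u (\<kappa> - {u}) * g (\<kappa> - {u})) = 0" .
  next
    fix \<rho> assume \<rho>: "\<rho> \<in> X" "Suc (card \<rho>) = n"
    have "0 = inverse (w \<rho>) * bdry key S x \<rho>"
      unfolding x_def[abs_def] bdry_diff
      using z(2) bdry_bdry[OF fin_face[OF \<rho>(1)] inj] by simp
    also have "\<dots> = (\<Sum>v\<in>S - \<rho>. f v * (orient key v \<rho> * g (insert v \<rho>)))"
      unfolding bdry_def sum_distrib_left
    proof (rule sum.cong[OF refl])
      fix v assume v: "v \<in> S - \<rho>"
      then have "w (insert v \<rho>) = f v * w \<rho>" "f v > 0" using fin_face[OF \<rho>(1)] pos by (auto simp: w_def)
      then show "inverse (w \<rho>) * (orient key v \<rho> * x (insert v \<rho>))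
          = f v * (orient key v \<rho> * g (insert v \<rho>))"
        by (simp add: g_def field_simps)
    qed
    finally show "(\<Sum>v\<in>S - \<rho>. f v * (orient key v \<rho> * g (insert v \<rho>))) = 0" by simp
  qed
  have "x \<tau> = 0" for \<tau>
    using x wpos[of \<tau>] g0[of \<tau>] unfolding g_def chain_def by (cases "\<tau> \<in> X") auto
  then have "bdry key S y = z" by (auto simp: x_def)
  with y show ?thesis by blast
qed

end


section \<open>Rainbow faces from fillings\<close>

definition rainbow :: "'a set \<Rightarrow> ('a \<Rightarrow> nat) \<Rightarrow> nat set \<Rightarrow> 'a set set" where
  "rainbow V col I = {\<tau>. \<tau> \<subseteq> V \<and> bij_betw col \<tau> I}"

text \<open>Since \<open>key\<close> sorts by colour first, passing from the vertices of a rainbow set to their colours keeps the signs.\<close>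
lemma orient_rainbow:
  assumes mono: "\<And>u v. u \<in> V \<Longrightarrow> v \<in> V \<Longrightarrow> col u < col v \<Longrightarrow> key u < key v"
    and "\<rho> \<in> rainbow V col J" "v \<in> V" "col v \<notin> J"
  shows "orient key v \<rho> = orient id (col v) J"
proof -
  have \<rho>: "\<rho> \<subseteq> V" "inj_on col \<rho>" "col ` \<rho> = J"
    using assms(2) by (auto simp: rainbow_def bij_betw_def)
  have less: "key w < key v \<longleftrightarrow> col w < col v" if "w \<in> \<rho>" for w
  proof -
    have "w \<in> V" "col w \<in> J" using that \<rho> by auto
    then have "w \<in> V" "col w \<noteq> col v" using assms(4) by auto
    then show ?thesis using mono[of w v] mono[of v w] assms(3)
      by (cases rule: linorder_cases[of "col w" "col v"]) auto
  qed
  have "{j \<in> J. id j < id (col v)} = col ` {w \<in> \<rho>. key w < key v}"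
    using less \<rho>(3) by auto
  moreover have "inj_on col {w \<in> \<rho>. key w < key v}" using \<rho>(2) by (rule inj_on_subset) auto
  ultimately show ?thesis unfolding orient_def by (simp add: card_image)
qed

text \<open>No element of \<open>\<rho>\<close> lies between two vertices of a colour absent from \<open>\<rho>\<close>, so these two are adjacent in
\<open>insert u (insert v \<rho>)\<close> and have opposite signs there.\<close>
lemma orient_same_color:
  fixes col :: "'a \<Rightarrow> nat"
  assumes mono: "\<And>u v. u \<in> V \<Longrightarrow> v \<in> V \<Longrightarrow> col u < col v \<Longrightarrow> key u < key v"
    and "finite \<rho>" "\<rho> \<subseteq> V" "u \<in> V" "v \<in> V" "u \<notin> \<rho>" "v \<notin> \<rho>"
    and "col u = col v" "col v \<notin> col ` \<rho>" "key u \<noteq> key v"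
  shows "orient key v (insert u \<rho>) = - orient key u (insert v \<rho>)"
proof -
  have "key w < key v \<longleftrightarrow> key w < key u" if "w \<in> \<rho>" for w
  proof -
    have "col w \<noteq> col v" using assms(9) that by (metis imageI)
    moreover have "w \<in> V" using assms(3) that by blast
    ultimately show ?thesis
      using mono[of w v] mono[of v w] mono[of w u] mono[of u w] assms(4,5,8)
      by (cases rule: linorder_cases[of "col w" "col v"]) auto
  qed
  then have "{w \<in> \<rho>. key w < key v} = {w \<in> \<rho>. key w < key u}" by auto
  then have "orient key v \<rho> = orient key u \<rho>" by (simp add: orient_def)
  then show ?thesis using assms by (auto simp: orient_insert)
qed

text \<open>Summing coefficients over rainbow faces commutes with boundaries, as expected of the map to the simplex of
colours. A face that is charged by \<open>c\<close> and covers a rainbow \<open>\<rho>\<close> with colours \<open>I - {j}\<close> either is rainbow with colours \<open>I\<close>, or repeats a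
colour; in the second case it covers a second rainbow set, obtained by exchanging its two vertices of that colour, and the two
contributions cancel.\<close>
lemma rainbow_boundary:
  assumes fin: "finite V" and inj: "inj_on key V"
    and mono: "\<And>u v. u \<in> V \<Longrightarrow> v \<in> V \<Longrightarrow> col u < col v \<Longrightarrow> key u < key v"
    and supp: "\<And>\<tau>. c \<tau> \<noteq> 0 \<Longrightarrow> col ` \<tau> \<subseteq> I"
    and j: "j \<in> I"
  shows "(\<Sum>\<rho>\<in>rainbow V col (I - {j}). bdry key V c \<rho>)
       = orient id j (I - {j}) * (\<Sum>\<tau>\<in>rainbow V col I. c \<tau>)"
proof -
  let ?R = "rainbow V col (I - {j})"
  define A where "A = Sigma ?R (\<lambda>\<rho>. V - \<rho>)"
  define A1 where "A1 = {(\<rho>, v) \<in> A. col v = j}"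
  define A2 where "A2 = {(\<rho>, v) \<in> A. col v \<in> I - {j}}"
  define t where "t = (\<lambda>(\<rho>, v). orient key v \<rho> * c (insert v \<rho>))"
  have fR: "finite ?R" by (rule finite_subset[of _ "Pow V"]) (use fin in \<open>auto simp: rainbow_def\<close>)
  have fA: "finite A" unfolding A_def using fR fin by blast
  have sub: "A1 \<subseteq> A" "A2 \<subseteq> A - A1" by (auto simp: A1_def A2_def)
  \<comment> \<open>\<open>A1\<close> holds the rainbow faces, \<open>A2\<close> those with a repeated colour.\<close>
  have "(\<Sum>\<rho>\<in>?R. bdry key V c \<rho>) = sum t A"
    unfolding bdry_def A_def t_def using fR fin by (subst sum.Sigma) auto
  also have "\<dots> = sum t A1 + sum t (A - A1)"
    using sum.subset_diff[OF sub(1) fA, of t] by simp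
  also have "sum t (A - A1) = sum t A2"
  proof (rule sum.mono_neutral_right)
    show "\<forall>p\<in>A - A1 - A2. t p = 0"
    proof
      fix p assume "p \<in> A - A1 - A2"
      then obtain \<rho> v where "p = (\<rho>, v)" "col v \<notin> I" using j by (auto simp: A1_def A2_def)
      then show "t p = 0" using supp[of "insert v \<rho>"] by (auto simp: t_def)
    qed
  qed (use fA sub in auto)
  also have "sum t A2 = 0"
  proof -
    \<comment> \<open>The sign-reversing involution: \<open>v\<close> replaces the vertex of \<open>\<rho>\<close> that has its colour.\<close>
    define \<phi> where "\<phi> = (\<lambda>(\<rho>, v). (insert v (\<rho> - {inv_into \<rho> col (col v)}), inv_into \<rho> col (col v)))"
    have \<phi>: "\<phi> x \<in> A2 \<and> \<phi> (\<phi> x) = x \<and> t (\<phi> x) = - t x" if xA: "x \<in> A2" for x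
    proof -
      obtain \<rho> v where x: "x = (\<rho>, v)" "\<rho> \<subseteq> V" "bij_betw col \<rho> (I - {j})" "v \<in> V" "v \<notin> \<rho>"
          "col v \<in> I - {j}"
        using xA by (auto simp: A2_def A_def rainbow_def)
      define p where "p = inv_into \<rho> col (col v)"
      define \<rho>' where "\<rho>' = \<rho> - {p}"
      have p: "p \<in> \<rho>" "col p = col v"
        using x unfolding p_def bij_betw_def by (metis inv_into_into f_inv_into_f)+
      then have \<rho>: "\<rho> = insert p \<rho>'" "p \<notin> \<rho>'" "v \<notin> \<rho>'" "p \<noteq> v" using x by (auto simp: \<rho>'_def)
      have nc: "col v \<notin> col ` \<rho>'"
        using x(3) p \<rho> by (auto simp: bij_betw_def)
      have injv: "inj_on col (insert v \<rho>')"
        using x(3) nc \<rho> by (auto simp: bij_betw_def)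
      have img: "col ` insert v \<rho>' = I - {j}" using x(3) p \<rho> by (auto simp: bij_betw_def)
      have \<phi>x: "\<phi> x = (insert v \<rho>', p)" by (simp add: \<phi>_def x(1) p_def \<rho>'_def)
      have "inv_into (insert v \<rho>') col (col p) = v"
        using inv_into_f_f[OF injv, of v] p by simp
      then have "\<phi> (\<phi> x) = (insert p (insert v \<rho>' - {v}), v)" unfolding \<phi>x by (simp add: \<phi>_def)
      also have "\<dots> = x" using \<rho> x by simp
      finally have "\<phi> (\<phi> x) = x" .
      moreover have "\<phi> x \<in> A2"
      proof -
        have "insert v \<rho>' \<subseteq> V" "p \<in> V" "p \<notin> insert v \<rho>'" "col p \<in> I - {j}" using x p \<rho> by auto
        then show ?thesis
          unfolding \<phi>x A2_def A_def rainbow_def bij_betw_def using injv img by simp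
      qed
      moreover have "t (\<phi> x) = - t x"
      proof -
        have "finite \<rho>'" "\<rho>' \<subseteq> V" "p \<in> V" using x \<rho> fin by (auto intro: finite_subset)
        moreover have "key v \<noteq> key p" using x p \<rho> inj by (metis inj_onD subsetD)
        ultimately have "orient key p (insert v \<rho>') = - orient key v (insert p \<rho>')"
          using x p \<rho> nc by (intro orient_same_color[where V=V and col=col, OF mono]) auto
        then show ?thesis unfolding \<phi>x by (simp add: t_def x(1) \<rho>(1) insert_commute)
      qed
      ultimately show ?thesis by simp
    qed
    have "sum t A2 = (\<Sum>x\<in>A2. - t x)"
      by (rule sum.reindex_bij_witness[where i=\<phi> and j=\<phi>]) (use \<phi> in auto)
    then show ?thesis by (simp add: sum_negf)
  qed
  also have "sum t A1 = (\<Sum>\<tau>\<in>rainbow V col I. orient id j (I - {j}) * c \<tau>)"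
  proof (rule sum.reindex_bij_witness[where i="\<lambda>\<tau>. (\<tau> - {inv_into \<tau> col j}, inv_into \<tau> col j)"
        and j="\<lambda>(\<rho>, v). insert v \<rho>"])
    fix x assume "x \<in> A1"
    then obtain \<rho> v where x: "x = (\<rho>, v)" "\<rho> \<in> ?R" "v \<in> V" "v \<notin> \<rho>" "col v = j"
      by (auto simp: A1_def A_def)
    have bij: "bij_betw col (insert v \<rho>) I"
      using x j by (auto simp: rainbow_def bij_betw_def)
    then show "(case x of (\<rho>, v) \<Rightarrow> insert v \<rho>) \<in> rainbow V col I"
      using x by (auto simp: rainbow_def)
    have "inv_into (insert v \<rho>) col j = v"
      using inv_into_f_f[OF bij_betw_imp_inj_on[OF bij], of v] x by simp
    then show "(\<lambda>\<tau>. (\<tau> - {inv_into \<tau> col j}, inv_into \<tau> col j)) (case x of (\<rho>, v) \<Rightarrow> insert v \<rho>) = x"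
      using x by simp
    show "orient id j (I - {j}) * c (case x of (\<rho>, v) \<Rightarrow> insert v \<rho>) = t x"
      using orient_rainbow[OF mono x(2,3)] x(5) by (simp add: t_def x(1))
  next
    fix \<tau> assume \<tau>: "\<tau> \<in> rainbow V col I"
    define p where "p = inv_into \<tau> col j"
    have p: "p \<in> \<tau>" "col p = j"
      using \<tau> j unfolding p_def rainbow_def bij_betw_def by (auto intro: inv_into_into f_inv_into_f)
    have "bij_betw col (\<tau> - {p}) (I - {j})"
      using \<tau> p by (auto simp: rainbow_def bij_betw_def inj_on_def)
    then show "(\<tau> - {inv_into \<tau> col j}, inv_into \<tau> col j) \<in> A1"
      using \<tau> p by (auto simp: A1_def A_def rainbow_def simp flip: p_def)
    show "(case (\<tau> - {inv_into \<tau> col j}, inv_into \<tau> col j) of (\<rho>, v) \<Rightarrow> insert v \<rho>) = \<tau>"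
      using p by (auto simp flip: p_def)
  qed
  finally show ?thesis by (simp add: sum_distrib_left)
qed

text \<open>A homological Sperner lemma. The chains \<open>c I\<close> form a chain map from the full simplex on the colours to the
complex, with \<open>c I\<close> carried by the faces coloured from \<open>I\<close>; they exist because the prescribed boundary is a cycle.
By \<open>rainbow_boundary\<close> and induction on \<open>I\<close>, the coefficients of \<open>c I\<close> on rainbow faces add up to \<open>1\<close>.\<close>
lemma rainbow_face_exists:
  fixes V :: "'a set" and A :: "nat set" and col :: "'a \<Rightarrow> nat"
  assumes fin: "finite V" "finite A" and inj: "inj_on key V"
    and mono: "\<And>u v. u \<in> V \<Longrightarrow> v \<in> V \<Longrightarrow> col u < col v \<Longrightarrow> key u < key v"
    and empty: "{} \<in> X"
    and fill: "\<And>I z. I \<subseteq> A \<Longrightarrow> I \<noteq> {} \<Longrightarrow> chain {\<tau> \<in> X. col ` \<tau> \<subseteq> I} (card I - 1) z \<Longrightarrow>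
        (\<And>\<rho>. bdry key V z \<rho> = 0) \<Longrightarrow>
        \<exists>y. chain {\<tau> \<in> X. col ` \<tau> \<subseteq> I} (card I) y \<and> bdry key V y = z"
  shows "\<exists>\<tau>\<in>X. bij_betw col \<tau> A"
proof -
  let ?X = "\<lambda>I. {\<tau> \<in> X. col ` \<tau> \<subseteq> I}"
  let ?z = "\<lambda>(c :: nat set \<Rightarrow> 'a set \<Rightarrow> real) I \<rho>. \<Sum>i\<in>I. orient id i (I - {i}) * c (I - {i}) \<rho>"
  have "\<exists>c. c {} = (\<lambda>\<tau>. of_bool (\<tau> = {})) \<and> (\<forall>I\<subseteq>A. card I \<le> k \<longrightarrow>
      chain (?X I) (card I) (c I) \<and> bdry key V (c I) = ?z c I)" for k
  proof (induction k)
    case 0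
    let ?c = "\<lambda>(_ :: nat set) \<tau> :: 'a set. of_bool (\<tau> = {}) :: real"
    have "chain (?X I) (card I) (?c I) \<and> bdry key V (?c I) = ?z ?c I" if "I \<subseteq> A" "card I \<le> 0" for I
    proof -
      have "I = {}" using that fin finite_subset by fastforce
      then show ?thesis using empty by (auto simp: chain_def bdry_def)
    qed
    then show ?case by (intro exI[of _ ?c]) blast
  next
    case (Suc k)
    then obtain c where c0: "c {} = (\<lambda>\<tau>. of_bool (\<tau> = {}))"
      and c: "\<And>I. I \<subseteq> A \<Longrightarrow> card I \<le> k \<Longrightarrow> chain (?X I) (card I) (c I)"
        "\<And>I. I \<subseteq> A \<Longrightarrow> card I \<le> k \<Longrightarrow> bdry key V (c I) = ?z c I" by blast
    have "\<exists>y. chain (?X I) (card I) y \<and> bdry key V y = ?z c I" if I: "I \<subseteq> A" "card I = Suc k" for I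
    proof (rule fill[OF I(1)])
      have fI: "finite I" using I fin finite_subset by blast
      have face: "I - {i} \<subseteq> A" "card (I - {i}) = k" if "i \<in> I" for i
        using that I fI by auto
      show "I \<noteq> {}" using I by auto
      show "chain (?X I) (card I - 1) (?z c I)"
        unfolding chain_def
      proof (intro allI impI)
        fix \<tau> assume "?z c I \<tau> \<noteq> 0"
        then obtain i where "i \<in> I" "c (I - {i}) \<tau> \<noteq> 0"
          by (metis (no_types, lifting) mult_zero_right sum.neutral)
        then show "\<tau> \<in> ?X I \<and> card \<tau> = card I - 1"
          using c(1)[of "I - {i}"] face[of i] I by (auto simp: chain_def)
      qed
      fix \<rho>
      have "bdry key V (?z c I) \<rho> = (\<Sum>i\<in>I. \<Sum>j\<in>I - {i}.
          orient id i (I - {i}) * (orient id j (I - {i} - {j}) * c (I - {i} - {j}) \<rho>))"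
        unfolding bdry_linear
      proof (intro sum.cong refl)
        fix i assume "i \<in> I"
        then show "orient id i (I - {i}) * bdry key V (c (I - {i})) \<rho> = (\<Sum>j\<in>I - {i}.
          orient id i (I - {i}) * (orient id j (I - {i} - {j}) * c (I - {i} - {j}) \<rho>))"
          using c(2)[of "I - {i}"] face[of i] by (simp add: sum_distrib_left)
      qed
      also have "\<dots> = 0"
      proof (rule sum_antisym_zero)
        fix u v assume uv: "u \<in> I" "v \<in> I" "u \<noteq> v"
        let ?J = "I - {u} - {v}"
        have "insert v ?J = I - {u}" "insert u ?J = I - {v}" "I - {v} - {u} = ?J" using uv by auto
        then have "orient id u (I - {u}) * orient id v ?J = - (orient id v (I - {v}) * orient id u ?J)"
          using orient_anticommute[of ?J u v id] uv fI by (simp add: mult.commute)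
        then show "orient id u (I - {u}) * (orient id v ?J * c ?J \<rho>)
            = - (orient id v (I - {v}) * (orient id u (I - {v} - {u}) * c (I - {v} - {u}) \<rho>))"
          unfolding \<open>I - {v} - {u} = ?J\<close> by (simp flip: mult.assoc)
      qed
      finally show "bdry key V (?z c I) \<rho> = 0" .
    qed
    then have "\<forall>I\<in>{I. I \<subseteq> A \<and> card I = Suc k}.
        \<exists>y. chain (?X I) (card I) y \<and> bdry key V y = ?z c I" by blast
    from bchoice[OF this] obtain y where y: "\<forall>I\<in>{I. I \<subseteq> A \<and> card I = Suc k}.
        chain (?X I) (card I) (y I) \<and> bdry key V (y I) = ?z c I" by blast
    define c' where "c' I = (if card I = Suc k then y I else c I)" for I
    have "c' {} = (\<lambda>\<tau>. of_bool (\<tau> = {}))" using c0 by (simp add: c'_def)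
    moreover have "chain (?X I) (card I) (c' I) \<and> bdry key V (c' I) = ?z c' I"
      if I: "I \<subseteq> A" "card I \<le> Suc k" for I
    proof -
      have "finite I" using I fin finite_subset by blast
      then have "c' (I - {i}) = c (I - {i})" if "i \<in> I" for i
        using that I card_Diff1_less[of I i] unfolding c'_def by simp
      then have "?z c' I = ?z c I" by (auto intro!: sum.cong)
      then show ?thesis using I y c[of I] by (cases "card I = Suc k") (simp_all add: c'_def)
    qed
    ultimately show ?case by blast
  qed
  from this[of "card A"] obtain c where c0: "c {} = (\<lambda>\<tau>. of_bool (\<tau> = {}))"
    and cA: "\<forall>I\<subseteq>A. card I \<le> card A \<longrightarrow> chain (?X I) (card I) (c I) \<and> bdry key V (c I) = ?z c I"
    by blast
  have c: "chain (?X I) (card I) (c I)" "bdry key V (c I) = ?z c I" if "I \<subseteq> A" for I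
    using cA that card_mono[OF fin(2) that] by blast+
  have degree: "(\<Sum>\<tau>\<in>rainbow V col I. c I \<tau>) = 1" if "I \<subseteq> A" for I
    using finite_subset[OF that fin(2)] that
  proof (induction I rule: finite_induct)
    case empty
    have "rainbow V col {} = {{}}" by (auto simp: rainbow_def bij_betw_def)
    then show ?case by (simp add: c0)
  next
    case (insert j J)
    let ?I = "insert j J"
    have J: "?I - {j} = J" using insert.hyps by auto
    have other: "c (?I - {i}) \<rho> = 0" if "\<rho> \<in> rainbow V col J" "i \<in> J" for \<rho> i
    proof (rule ccontr)
      assume "c (?I - {i}) \<rho> \<noteq> 0"
      then have "col ` \<rho> \<subseteq> ?I - {i}" using c(1)[of "?I - {i}"] insert.prems by (auto simp: chain_def)
      then show False using that by (auto simp: rainbow_def bij_betw_def)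
    qed
    have "orient id j J * (\<Sum>\<tau>\<in>rainbow V col ?I. c ?I \<tau>) = (\<Sum>\<rho>\<in>rainbow V col J. bdry key V (c ?I) \<rho>)"
      using rainbow_boundary[where c="c ?I" and I="?I" and j=j and V=V and col=col, OF fin(1) inj mono] c(1)[OF insert.prems] unfolding J
      by (auto simp: chain_def)
    also have "\<dots> = (\<Sum>\<rho>\<in>rainbow V col J. orient id j J * c J \<rho>)"
    proof (rule sum.cong[OF refl])
      fix \<rho> assume \<rho>: "\<rho> \<in> rainbow V col J"
      have "?z c ?I \<rho> = orient id j (?I - {j}) * c (?I - {j}) \<rho> + (\<Sum>i\<in>J. orient id i (?I - {i}) * c (?I - {i}) \<rho>)"
        using insert.hyps by (rule sum.insert)
      also have "(\<Sum>i\<in>J. orient id i (?I - {i}) * c (?I - {i}) \<rho>) = 0"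
        using other[OF \<rho>] by (intro sum.neutral) simp
      finally show "bdry key V (c ?I) \<rho> = orient id j J * c J \<rho>"
        unfolding c(2)[OF insert.prems] J add_0_right .
    qed
    also have "\<dots> = orient id j J * 1"
      using insert by (simp flip: sum_distrib_left)
    finally show ?case using orient_square[of id j J] by (metis mult_cancel_left mult_zero_left zero_neq_one)
  qed
  then have "(\<Sum>\<tau>\<in>rainbow V col A. c A \<tau>) \<noteq> 0" by simp
  then obtain \<tau> where "\<tau> \<in> rainbow V col A" "c A \<tau> \<noteq> 0" by (meson sum.neutral)
  then show ?thesis using c(1)[of A] by (auto simp: chain_def rainbow_def)
qed


section \<open>Matroid closure and counting\<close>

text \<open>The form is the sum, over the values \<open>F\<close> of \<open>h\<close>, of the squares of the sums of \<open>a\<close> over the fibres.\<close>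
lemma fibre_form_nonneg:
  fixes a :: "'a \<Rightarrow> real"
  assumes "finite E"
  shows "0 \<le> (\<Sum>u\<in>E. \<Sum>v\<in>E. of_bool (h u = h v) * a u * a v)"
proof -
  have "(\<Sum>u\<in>E. \<Sum>v\<in>E. of_bool (h u = h v) * a u * a v)
      = (\<Sum>u\<in>E. \<Sum>v\<in>E. \<Sum>F\<in>h ` E. (of_bool (h u = F) * a u) * (of_bool (h v = F) * a v))"
  proof (intro sum.cong refl)
    fix u v assume "u \<in> E" "v \<in> E"
    have "(\<Sum>F\<in>h ` E. (of_bool (h u = F) * a u) * (of_bool (h v = F) * a v))
        = (\<Sum>F\<in>{h u}. (of_bool (h u = F) * a u) * (of_bool (h v = F) * a v))"
      using assms \<open>u \<in> E\<close> by (intro sum.mono_neutral_right) auto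
    then show "of_bool (h u = h v) * a u * a v
        = (\<Sum>F\<in>h ` E. (of_bool (h u = F) * a u) * (of_bool (h v = F) * a v))"
      by (cases "h u = h v") auto
  qed
  also have "\<dots> = (\<Sum>u\<in>E. \<Sum>F\<in>h ` E. \<Sum>v\<in>E. (of_bool (h u = F) * a u) * (of_bool (h v = F) * a v))"
    by (intro sum.cong refl sum.swap)
  also have "\<dots> = (\<Sum>F\<in>h ` E. \<Sum>u\<in>E. \<Sum>v\<in>E. (of_bool (h u = F) * a u) * (of_bool (h v = F) * a v))"
    by (rule sum.swap)
  also have "\<dots> = (\<Sum>F\<in>h ` E. (\<Sum>u\<in>E. of_bool (h u = F) * a u)^2)"
    unfolding power2_eq_square sum_product ..
  also have "\<dots> \<ge> 0" by (intro sum_nonneg) simp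
  finally show ?thesis .
qed

lemma card_small_subsets:
  assumes "finite A"
  shows "card {\<sigma>. \<sigma> \<subseteq> A \<and> card \<sigma> < d} = (\<Sum>j<d. card A choose j)"
proof -
  have "{\<sigma>. \<sigma> \<subseteq> A \<and> card \<sigma> < d} = (\<Union>j\<in>{..<d}. {\<sigma>. \<sigma> \<subseteq> A \<and> card \<sigma> = j})" by auto
  also have "card \<dots> = (\<Sum>j<d. card {\<sigma>. \<sigma> \<subseteq> A \<and> card \<sigma> = j})"
    using assms by (intro card_UN_disjoint) auto
  also have "\<dots> = (\<Sum>j<d. card A choose j)" using assms by (simp add: n_subsets)
  finally show ?thesis .
qed

text \<open>Both sides count the pairs of an element \<open>u\<close> of an \<open>n\<close>-element set and a subset of fewer than \<open>d\<close> of the others; on the left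
\<open>r\<close> is the size of that subset with \<open>u\<close> added.\<close>
lemma weighted_binomial_sum:
  "(\<Sum>r=1..d. real r * real (n choose r)) = real n * real (\<Sum>j<d. (n - 1) choose j)"
proof -
  have "real (Suc j) * real (n choose Suc j) = real n * real ((n - 1) choose j)" for j
    using binomial_absorption[of j n] by (metis of_nat_mult)
  then have "(\<Sum>j<d. real (Suc j) * real (n choose Suc j)) = (\<Sum>j<d. real n * real ((n - 1) choose j))"
    by (intro sum.cong) auto
  then show ?thesis
    unfolding One_nat_def sum.atLeast1_atMost_eq of_nat_sum sum_distrib_left .
qed

context matroid
begin

lemma finite_sub: "A \<subseteq> V \<Longrightarrow> finite A"
  using finite_ground finite_subset by blast

text \<open>An independent subset of \<open>B \<union> {w}\<close> larger than a basis \<open>X\<close> of \<open>A\<close> would extend \<open>X\<close> by an element of \<open>B\<close> or by \<open>w\<close>,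
so a \<open>w\<close> that does not raise the rank of \<open>A\<close> does not raise that of \<open>B\<close> either.\<close>
lemma cl_eq_of_rank:
  assumes "A \<subseteq> B" "B \<subseteq> V" "mat_rank indep A = mat_rank indep B"
  shows "mat_cl V indep A = mat_cl V indep B"
proof -
  have "mat_rank indep (A \<union> {w}) = mat_rank indep A \<longleftrightarrow> mat_rank indep (B \<union> {w}) = mat_rank indep B"
    if w: "w \<in> V" for w
  proof
    assume *: "mat_rank indep (B \<union> {w}) = mat_rank indep B"
    have "mat_rank indep (A \<union> {w}) \<le> mat_rank indep (B \<union> {w})"
      using assms w by (intro rank_mono) auto
    moreover have "mat_rank indep A \<le> mat_rank indep (A \<union> {w})"
      using assms w by (intro rank_mono) auto
    ultimately show "mat_rank indep (A \<union> {w}) = mat_rank indep A" using * assms(3) by simp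
  next
    assume *: "mat_rank indep (A \<union> {w}) = mat_rank indep A"
    obtain X where X: "X \<subseteq> A" "indep X" "card X = mat_rank indep A"
      using rank_attained assms by (metis subset_trans)
    obtain Y where Y: "Y \<subseteq> B \<union> {w}" "indep Y" "card Y = mat_rank indep (B \<union> {w})"
      using rank_attained[of "B \<union> {w}"] assms w by auto
    have "\<not> card X < card Y"
    proof
      assume "card X < card Y"
      then obtain y where y: "y \<in> Y - X" "indep (insert y X)"
        using indep_augment X(2) Y(2) by blast
      have c: "card (insert y X) = Suc (card X)"
        using y X(2) indep_subset_ground[OF X(2)] finite_sub by auto
      consider "y \<in> B" | "y = w" using y Y by auto
      then show False
      proof cases
        case 1
        then show False using rank_ge_card[of B "insert y X"] c y X assms by auto
      next
        case 2
        then show False using rank_ge_card[of "A \<union> {w}" "insert y X"] c y X assms w * by auto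
      qed
    qed
    moreover have "mat_rank indep B \<le> mat_rank indep (B \<union> {w})"
      using assms w by (intro rank_mono) auto
    ultimately show "mat_rank indep (B \<union> {w}) = mat_rank indep B" using X Y assms(3) by simp
  qed
  then show ?thesis unfolding mat_cl_def by auto
qed

lemma rank_cl:
  assumes "A \<subseteq> V"
  shows "mat_rank indep (mat_cl V indep A) = mat_rank indep A"
proof -
  have sub: "A \<subseteq> mat_cl V indep A" "mat_cl V indep A \<subseteq> V"
    using assms by (auto simp: mat_cl_def insert_absorb)
  obtain X where X: "X \<subseteq> A" "indep X" "card X = mat_rank indep A"
    using rank_attained assms by metis
  obtain Y where Y: "Y \<subseteq> mat_cl V indep A" "indep Y" "card Y = mat_rank indep (mat_cl V indep A)"
    using rank_attained[OF sub(2)] by metis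
  have "\<not> card X < card Y"
  proof
    assume "card X < card Y"
    then obtain y where y: "y \<in> Y - X" "indep (insert y X)"
      using indep_augment X(2) Y(2) by blast
    have "card (insert y X) = Suc (card X)"
      using y X(2) indep_subset_ground[OF X(2)] finite_sub by auto
    moreover have "y \<in> V" "mat_rank indep (A \<union> {y}) = mat_rank indep A" using y Y by (auto simp: mat_cl_def)
    ultimately show False using rank_ge_card[of "A \<union> {y}" "insert y X"] y X assms by auto
  qed
  then show ?thesis using X Y rank_mono[OF sub] by simp
qed

lemma cl_is_flat:
  assumes "A \<subseteq> V"
  shows "A \<subseteq> mat_cl V indep A" "mat_flat V indep (mat_cl V indep A)"
proof -
  show sub: "A \<subseteq> mat_cl V indep A" using assms by (auto simp: mat_cl_def insert_absorb)
  show "mat_flat V indep (mat_cl V indep A)"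
    unfolding mat_flat_def
    using cl_eq_of_rank[OF sub _ rank_cl[OF assms, symmetric]] by (auto simp: mat_cl_def)
qed

text \<open>Deleting any element of a circuit does not lower the rank, so both closures are the closure of the circuit.\<close>
lemma circuit_cl_eq:
  assumes "D \<subseteq> V" "\<not> indep D" "\<And>x. x \<in> D \<Longrightarrow> indep (D - {x})" "u \<in> D" "v \<in> D"
  shows "mat_cl V indep (D - {u}) = mat_cl V indep (D - {v})"
proof -
  have "mat_cl V indep (D - {x}) = mat_cl V indep D" if x: "x \<in> D" for x
  proof (rule cl_eq_of_rank)
    obtain X where X: "X \<subseteq> D" "indep X" "card X = mat_rank indep D"
      using rank_attained assms by metis
    then have "X \<subset> D" using assms(2) by auto
    then have "card X < card D" using finite_sub[OF assms(1)] psubset_card_mono by blast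
    then have "mat_rank indep D \<le> card (D - {x})" using X x finite_sub[OF assms(1)] by simp
    also have "\<dots> = mat_rank indep (D - {x})" using rank_indep assms(3) x by simp
    finally show "mat_rank indep (D - {x}) = mat_rank indep D"
      using rank_mono[of "D - {x}" D] assms(1) by auto
  qed (use assms in auto)
  then show ?thesis using assms by simp
qed

definition gp_complex :: "nat \<Rightarrow> 'a set set" where
  "gp_complex d = {\<tau>. \<tau> \<subseteq> V \<and> (\<forall>\<sigma>\<subseteq>\<tau>. card \<sigma> \<le> d + 1 \<longrightarrow> indep \<sigma>)}"

lemma gp_complex_general_position:
  assumes "\<tau> \<in> gp_complex d"
  shows "general_position V indep d \<tau>"
  unfolding general_position_def
proof (intro conjI allI impI)
  show "\<tau> \<subseteq> V" using assms by (simp add: gp_complex_def)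
  fix k F assume k: "1 \<le> k \<and> k \<le> d \<and> mat_flat V indep F \<and> mat_rank indep F = k"
  have FV: "F \<subseteq> V" using k by (auto simp: mat_flat_def mat_cl_def)
  show "card (F \<inter> \<tau>) \<le> k"
  proof (rule ccontr)
    assume "\<not> card (F \<inter> \<tau>) \<le> k"
    then obtain \<sigma> where \<sigma>: "\<sigma> \<subseteq> F \<inter> \<tau>" "card \<sigma> = Suc k"
      by (meson not_less_eq_eq obtain_subset_with_card_n)
    then have "indep \<sigma>" using assms k by (auto simp: gp_complex_def)
    then show False using rank_ge_card[OF FV, of \<sigma>] \<sigma> k by auto
  qed
qed

text \<open>The matrix \<open>agree d \<rho>\<close> is a sum of matrices of equivalence relations, one for each \<open>\<sigma>\<close>. On \<open>ext \<rho>\<close> it dominates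
the clash relation, and it is what fractional general position controls.\<close>
definition agree :: "nat \<Rightarrow> 'a set \<Rightarrow> 'a \<Rightarrow> 'a \<Rightarrow> real" where
  "agree d \<rho> u v = (\<Sum>\<sigma> | \<sigma> \<subseteq> \<rho> \<and> card \<sigma> < d.
      of_bool (mat_cl V indep (insert u \<sigma>) = mat_cl V indep (insert v \<sigma>)))"

lemma agree_nonneg: "0 \<le> agree d \<rho> u v"
  unfolding agree_def by (intro sum_nonneg) simp

lemma small_circuit:
  assumes "\<kappa> \<subseteq> V" "\<kappa> \<notin> gp_complex d"
  obtains D where "D \<subseteq> \<kappa>" "card D \<le> d + 1" "\<not> indep D" "\<And>x. x \<in> D \<Longrightarrow> indep (D - {x})"
proof -
  let ?P = "\<lambda>D. D \<subseteq> \<kappa> \<and> card D \<le> d + 1 \<and> \<not> indep D"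
  have "\<exists>D. ?P D" using assms by (auto simp: gp_complex_def)
  then obtain D where D: "?P D" "\<And>D'. ?P D' \<Longrightarrow> card D \<le> card D'"
    using ex_has_least_nat[of ?P _ card] by blast
  have "indep (D - {x})" if "x \<in> D" for x
  proof (rule ccontr)
    assume "\<not> indep (D - {x})"
    moreover have "card (D - {x}) < card D"
      using that D(1) assms(1) finite_sub by (meson card_Diff1_less subset_trans)
    ultimately show False using D(1) D(2)[of "D - {x}"] by auto
  qed
  with D that show thesis by blast
qed

lemma agree_ge_1:
  assumes D: "D \<subseteq> V" "card D \<le> d + 1" "\<not> indep D" "\<And>x. x \<in> D \<Longrightarrow> indep (D - {x})"
    and uv: "u \<in> D" "v \<in> D" "u \<noteq> v" and \<rho>: "D - {u, v} \<subseteq> \<rho>" "finite \<rho>"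
  shows "1 \<le> agree d \<rho> u v"
proof -
  let ?\<sigma> = "D - {u, v}"
  have fD: "finite D" using D finite_sub by blast
  have "card {u, v} \<le> card D" using uv fD by (intro card_mono) auto
  then have "card ?\<sigma> < d" using uv D(2) fD by (simp add: card_Diff_subset)
  moreover have "insert u ?\<sigma> = D - {v}" "insert v ?\<sigma> = D - {u}" using uv by auto
  ultimately have *: "?\<sigma> \<in> {\<sigma>. \<sigma> \<subseteq> \<rho> \<and> card \<sigma> < d}"
      "mat_cl V indep (insert u ?\<sigma>) = mat_cl V indep (insert v ?\<sigma>)"
    using circuit_cl_eq[OF D(1,3,4) uv(1,2)] \<rho> by auto
  have "of_bool (mat_cl V indep (insert u ?\<sigma>) = mat_cl V indep (insert v ?\<sigma>)) \<le> agree d \<rho> u v"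
    unfolding agree_def using *(1) \<rho>(2) by (intro member_le_sum) auto
  then show ?thesis using *(2) by simp
qed

text \<open>A minimal dependent \<open>D \<subseteq> insert v \<tau>\<close> of size at most \<open>d + 1\<close> contains \<open>v\<close>, and a second element \<open>u\<close> as there are no loops;
\<open>D - {u, v}\<close> is the \<open>\<sigma>\<close> counted by \<open>agree\<close>.\<close>
lemma agree_blocked:
  assumes "loopless V indep" "1 \<le> d" "\<tau> \<in> gp_complex d" "v \<in> V" "v \<notin> \<tau>" "insert v \<tau> \<notin> gp_complex d"
  shows "\<exists>u\<in>\<tau>. 1 \<le> agree d (\<tau> - {u}) u v"
proof -
  have \<tau>: "\<tau> \<subseteq> V" using assms by (simp add: gp_complex_def)
  obtain D where D: "D \<subseteq> insert v \<tau>" "card D \<le> d + 1" "\<not> indep D" "\<And>x. x \<in> D \<Longrightarrow> indep (D - {x})"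
    using small_circuit[of "insert v \<tau>" d] assms \<tau> by auto
  have v: "v \<in> D" using D assms(3) by (auto simp: gp_complex_def)
  have "D \<noteq> {v}" using D(3) assms(1,4) by (auto simp: loopless_def)
  then obtain u where u: "u \<in> D" "u \<noteq> v" using v by blast
  then have "1 \<le> agree d (\<tau> - {u}) u v"
    using D v \<tau> assms finite_sub[OF \<tau>] by (intro agree_ge_1[of D]) auto
  then show ?thesis using u D by auto
qed

text \<open>A minimal dependent set of size at most \<open>d + 1\<close> in \<open>insert u (insert v \<rho>)\<close> lies in neither of the two faces, hence contains both \<open>u\<close> and \<open>v\<close>.\<close>
lemma agree_clash:
  assumes "\<rho> \<subseteq> V" "insert u \<rho> \<in> gp_complex d" "insert v \<rho> \<in> gp_complex d" "insert u (insert v \<rho>) \<notin> gp_complex d" "u \<noteq> v"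
  shows "1 \<le> agree d \<rho> u v"
proof -
  have "insert u (insert v \<rho>) \<subseteq> V" using assms by (auto simp: gp_complex_def)
  moreover obtain D where D: "D \<subseteq> insert u (insert v \<rho>)" "card D \<le> d + 1" "\<not> indep D"
      "\<And>x. x \<in> D \<Longrightarrow> indep (D - {x})"
    by (rule small_circuit[OF \<open>insert u (insert v \<rho>) \<subseteq> V\<close> assms(4)]) blast
  ultimately have DV: "D \<subseteq> V" by blast
  have not_in: "\<not> D \<subseteq> \<tau>" if "\<tau> \<in> gp_complex d" for \<tau> using that D(2,3) unfolding gp_complex_def by blast
  have "u \<in> D" using not_in[OF assms(3)] D(1) by blast
  moreover have "v \<in> D" using not_in[OF assms(2)] D(1) by blast
  moreover have "D - {u, v} \<subseteq> \<rho>" using D(1) by blast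
  ultimately show ?thesis
    using agree_ge_1[OF DV D(2,3,4) _ _ assms(5)] finite_sub[OF assms(1)] by blast
qed

text \<open>The defining inequality of fractional general position for the flat spanned by \<open>insert u \<sigma>\<close>, whose rank is \<open>card \<sigma> + 1\<close>.\<close>
lemma flag_sum_le:
  assumes f: "fractional_general_position V indep d S f" and "S \<subseteq> V"
    and \<sigma>: "\<sigma> \<subseteq> S" "card \<sigma> < d" "u \<in> S" "u \<notin> \<sigma>" "indep (insert u \<sigma>)"
  shows "(\<Sum>v | v \<in> S \<and> mat_cl V indep (insert v \<sigma>) = mat_cl V indep (insert u \<sigma>). f v) \<le> d"
proof -
  let ?F = "mat_cl V indep (insert u \<sigma>)"
  have sub: "insert u \<sigma> \<subseteq> V" using assms by auto
  have f\<sigma>: "finite \<sigma>" using sub finite_sub by auto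
  have "mat_rank indep ?F = card \<sigma> + 1"
    using rank_cl[OF sub] rank_indep[OF \<sigma>(5)] f\<sigma> \<sigma>(4) by simp
  moreover have "\<sigma> \<subseteq> ?F \<inter> S" "mat_flat V indep ?F" using cl_is_flat[OF sub] \<sigma> by auto
  moreover have "1 \<le> k \<and> k \<le> d \<and> mat_flat V indep F \<and> mat_rank indep F = k
      \<and> \<sigma> \<subseteq> F \<inter> S \<and> card \<sigma> = k - 1
    \<longrightarrow> (\<Sum>v | v \<in> S \<and> mat_cl V indep ({v} \<union> \<sigma>) = F. f v) \<le> real d" for k F
    using f unfolding fractional_general_position_def by blast
  note this[of "card \<sigma> + 1" ?F]
  ultimately show ?thesis using \<sigma>(2) by simp
qed

text \<open>Here \<open>cycle_bounds\<close> is applied with \<open>Q = agree d\<close>. For \<open>v \<in> nonext \<tau>\<close> the weight \<open>f v\<close> in \<open>sum f (nonext \<tau>)\<close>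
is paid for by a single \<open>u \<in> \<tau>\<close>: either \<open>insert v (\<tau> - {u})\<close> is a face for some \<open>u\<close>, and then \<open>u\<close> and \<open>v\<close> clash, which
saves \<open>1\<close> in the surplus \<open>agree - clash\<close>; or no such \<open>u\<close> exists, and then the \<open>agree\<close> entry from \<open>agree_blocked\<close> has not been
spent. So the whole row is at most the sum of all \<open>agree\<close> entries weighted by \<open>f\<close>.\<close>
lemma cycle_bounds_of_fractional:
  assumes ll: "loopless V indep" and d: "1 \<le> d" and S: "S \<subseteq> V" and inj: "inj_on key S"
    and f0: "fractional_general_position V indep d S f0"
    and big: "real d * (\<Sum>r=1..d. real r * real (n choose r)) < sum f0 S"
    and z: "chain {\<tau> \<in> gp_complex d. \<tau> \<subseteq> S} n z" "\<And>\<rho>. bdry key S z \<rho> = 0"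
  shows "\<exists>y. chain {\<tau> \<in> gp_complex d. \<tau> \<subseteq> S} (Suc n) y \<and> bdry key S y = z"
proof -
  let ?X = "{\<tau> \<in> gp_complex d. \<tau> \<subseteq> S}"
  define \<beta> where "\<beta> = real d * (\<Sum>r=1..d. real r * real (n choose r))"
  have \<beta>: "0 \<le> \<beta>" "\<beta> < sum f0 S" using big unfolding \<beta>_def by (auto intro!: mult_nonneg_nonneg sum_nonneg)
  have fS: "finite S" using S finite_sub by blast
  have cS: "0 < real (card S)" using \<beta> fS by (cases "S = {}") (auto simp: card_gt_0_iff)
  interpret ordered_complex S ?X key
    by unfold_locales (use fS inj in \<open>auto simp: gp_complex_def\<close>)
  \<comment> \<open>Mixing \<open>f0\<close> with the constant weight of sum \<open>d\<close> makes it positive and keeps it feasible; this \<open>\<epsilon>\<close> loses at most half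
      of the excess of \<open>sum f0 S\<close> over \<open>\<beta>\<close>.\<close>
  define \<epsilon> where "\<epsilon> = (sum f0 S - \<beta>) / (2 * sum f0 S)"
  have \<epsilon>: "0 < \<epsilon>" "\<epsilon> < 1" using \<beta> by (auto simp: \<epsilon>_def field_simps)
  define f where "f v = (1 - \<epsilon>) * f0 v + \<epsilon> * (d / card S)" for v
  have f0_nn: "0 \<le> f0 v" if "v \<in> S" for v using f0 that by (auto simp: fractional_general_position_def)
  have fpos: "0 < f v" if "v \<in> S" for v
    unfolding f_def using f0_nn[OF that] \<epsilon> d cS by (intro add_nonneg_pos mult_nonneg_nonneg mult_pos_pos) auto
  have sum_f: "sum f T = (1 - \<epsilon>) * sum f0 T + \<epsilon> * (d * (card T / card S))" for T
    by (simp add: f_def sum.distrib sum_distrib_left)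
  have sumS: "\<beta> < sum f S"
  proof -
    have "(1 - \<epsilon>) * sum f0 S = (sum f0 S + \<beta>) / 2"
      using \<beta> by (simp add: \<epsilon>_def field_simps)
    moreover have "0 \<le> \<epsilon> * (d * (card S / card S))" using \<epsilon> by simp
    ultimately show ?thesis using \<beta> unfolding sum_f by simp
  qed
  have flag: "(\<Sum>v | v \<in> S \<and> mat_cl V indep (insert v \<sigma>) = mat_cl V indep (insert u \<sigma>). f v) \<le> d"
    if "\<sigma> \<subseteq> S" "card \<sigma> < d" "u \<in> S" "u \<notin> \<sigma>" "indep (insert u \<sigma>)" for \<sigma> u
  proof -
    let ?T = "{v. v \<in> S \<and> mat_cl V indep (insert v \<sigma>) = mat_cl V indep (insert u \<sigma>)}"
    have "card ?T \<le> card S" using fS by (intro card_mono) auto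
    then have "card ?T / card S \<le> 1" using cS by simp
    then have "real d * (card ?T / card S) \<le> real d * 1" by (rule mult_left_mono) simp
    then have "real d * (card ?T / card S) \<le> real d" by (simp only: mult_1_right)
    then have "sum f ?T \<le> (1 - \<epsilon>) * d + \<epsilon> * d"
      unfolding sum_f using flag_sum_le[OF f0 S that] \<epsilon> by (intro add_mono mult_left_mono) simp_all
    then show ?thesis by (simp add: algebra_simps)
  qed
  show ?thesis
  proof (rule cycle_bounds[where f=f and Q="agree d", OF fpos _ _ _ _ z])
    fix \<rho> and a :: "'a \<Rightarrow> real"
    have "(\<Sum>u\<in>ext \<rho>. \<Sum>v\<in>ext \<rho>. agree d \<rho> u v * a u * a v)
        = (\<Sum>\<sigma> | \<sigma> \<subseteq> \<rho> \<and> card \<sigma> < d. \<Sum>u\<in>ext \<rho>. \<Sum>v\<in>ext \<rho>.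
            of_bool (mat_cl V indep (insert u \<sigma>) = mat_cl V indep (insert v \<sigma>)) * a u * a v)"
      unfolding agree_def sum_distrib_right
      by (subst sum.swap[of _ "{\<sigma>. \<sigma> \<subseteq> \<rho> \<and> card \<sigma> < d}"], intro sum.cong refl sum.swap)
    also have "\<dots> \<ge> 0"
      using fS by (intro sum_nonneg fibre_form_nonneg) (auto simp: ext_def)
    finally show "0 \<le> (\<Sum>u\<in>ext \<rho>. \<Sum>v\<in>ext \<rho>. agree d \<rho> u v * a u * a v)" .
  next
    show "agree d \<rho> u v = agree d \<rho> v u" for \<rho> u v
      unfolding agree_def by (intro sum.cong refl arg_cong[where f=of_bool] eq_commute)
  next
    fix \<rho> u v assume *: "\<rho> \<in> ?X" "u \<in> ext \<rho>" "v \<in> ext \<rho>"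
    then have sub: "insert u \<rho> \<in> gp_complex d" "insert v \<rho> \<in> gp_complex d" "\<rho> \<subseteq> V" "insert u (insert v \<rho>) \<subseteq> S"
      using S by (auto simp: ext_def)
    show "clash \<rho> u v \<le> agree d \<rho> u v"
    proof (cases "u \<noteq> v \<and> insert u (insert v \<rho>) \<notin> gp_complex d")
      case True
      then show ?thesis using agree_clash[OF sub(3,1,2)] by (simp add: clash_def)
    next
      case False
      then have "clash \<rho> u v = 0" using sub(4) by (auto simp: clash_def)
      then show ?thesis using agree_nonneg by simp
    qed
  next
    fix \<tau> assume \<tau>: "\<tau> \<in> ?X" "card \<tau> = n"
    have f\<tau>: "finite \<tau>" using fin_face \<tau> by blast
    let ?k = "\<lambda>u v. of_bool (v \<in> ext (\<tau> - {u})) * (agree d (\<tau> - {u}) u v - clash (\<tau> - {u}) u v)"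
    have "sum f (nonext \<tau>) = (\<Sum>v\<in>S. of_bool (v \<in> nonext \<tau>) * f v)"
      using fS by (intro sum.mono_neutral_cong_left) (auto simp: nonext_def)
    moreover have "(\<Sum>u\<in>\<tau>. \<Sum>v\<in>ext (\<tau> - {u}). (agree d (\<tau> - {u}) u v - clash (\<tau> - {u}) u v) * f v)
        = (\<Sum>u\<in>\<tau>. \<Sum>v\<in>S. ?k u v * f v)"
      using fS by (intro sum.cong refl sum.mono_neutral_cong_left) (auto simp: ext_def)
    moreover have "\<dots> = (\<Sum>v\<in>S. (\<Sum>u\<in>\<tau>. ?k u v) * f v)"
      unfolding sum_distrib_right by (rule sum.swap)
    ultimately have "sum f (nonext \<tau>) + (\<Sum>u\<in>\<tau>. \<Sum>v\<in>ext (\<tau> - {u}).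
          (agree d (\<tau> - {u}) u v - clash (\<tau> - {u}) u v) * f v)
        = (\<Sum>v\<in>S. (of_bool (v \<in> nonext \<tau>) + (\<Sum>u\<in>\<tau>. ?k u v)) * f v)"
      by (simp add: sum.distrib algebra_simps)
    also have "\<dots> \<le> (\<Sum>v\<in>S. (\<Sum>u\<in>\<tau>. agree d (\<tau> - {u}) u v) * f v)"
    proof (intro sum_mono mult_right_mono)
      fix v assume v: "v \<in> S"
      show "0 \<le> f v" using fpos[OF v] by simp
      have k: "?k u v \<le> agree d (\<tau> - {u}) u v" for u
        using agree_nonneg[of d "\<tau> - {u}" u v] by (auto simp: clash_def)
      show "of_bool (v \<in> nonext \<tau>) + (\<Sum>u\<in>\<tau>. ?k u v) \<le> (\<Sum>u\<in>\<tau>. agree d (\<tau> - {u}) u v)"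
      proof (cases "v \<in> nonext \<tau>")
        case False
        then show ?thesis using k by (auto intro: sum_mono)
      next
        case True
        then have nx: "v \<notin> \<tau>" "insert v \<tau> \<notin> gp_complex d" using v \<tau> by (auto simp: nonext_def)
        have "\<exists>u\<in>\<tau>. ?k u v + 1 \<le> agree d (\<tau> - {u}) u v"
        proof (cases "\<exists>u\<in>\<tau>. v \<in> ext (\<tau> - {u})")
          case True
          then obtain u where u: "u \<in> \<tau>" "v \<in> ext (\<tau> - {u})" by blast
          then have "insert u (insert v (\<tau> - {u})) = insert v \<tau>" by auto
          then have "clash (\<tau> - {u}) u v = 1" using u nx by (auto simp: clash_def)
          then show ?thesis using u by (intro bexI[of _ u]) auto
        next
          case False
          then show ?thesis
            using agree_blocked[OF ll d, of \<tau> v] \<tau> v S nx by fastforce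
        qed
        then obtain u where u: "u \<in> \<tau>" "?k u v + 1 \<le> agree d (\<tau> - {u}) u v" by blast
        have "1 + (\<Sum>u\<in>\<tau>. ?k u v) = (?k u v + 1) + (\<Sum>u\<in>\<tau> - {u}. ?k u v)"
          using sum.remove[OF f\<tau> u(1), of "\<lambda>u. ?k u v"] by simp
        also have "\<dots> \<le> agree d (\<tau> - {u}) u v + (\<Sum>u\<in>\<tau> - {u}. agree d (\<tau> - {u}) u v)"
          by (intro add_mono u(2) sum_mono k)
        also have "\<dots> = (\<Sum>u\<in>\<tau>. agree d (\<tau> - {u}) u v)"
          using sum.remove[OF f\<tau> u(1), of "\<lambda>u. agree d (\<tau> - {u}) u v"] by simp
        finally show ?thesis using True by simp
      qed
    qed
    also have "\<dots> = (\<Sum>u\<in>\<tau>. \<Sum>v\<in>S. agree d (\<tau> - {u}) u v * f v)"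
      unfolding sum_distrib_right by (rule sum.swap)
    also have "\<dots> \<le> (\<Sum>u\<in>\<tau>. real d * real (\<Sum>j<d. (n - 1) choose j))"
    proof (rule sum_mono)
      fix u assume u: "u \<in> \<tau>"
      let ?\<Sigma> = "{\<sigma>. \<sigma> \<subseteq> \<tau> - {u} \<and> card \<sigma> < d}"
      have "(\<Sum>v\<in>S. agree d (\<tau> - {u}) u v * f v) = (\<Sum>\<sigma>\<in>?\<Sigma>. \<Sum>v\<in>S.
          of_bool (mat_cl V indep (insert u \<sigma>) = mat_cl V indep (insert v \<sigma>)) * f v)"
        unfolding agree_def sum_distrib_right by (rule sum.swap)
      also have "\<dots> \<le> (\<Sum>\<sigma>\<in>?\<Sigma>. real d)"
      proof (rule sum_mono)
        fix \<sigma> assume \<sigma>: "\<sigma> \<in> ?\<Sigma>"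
        then have "finite \<sigma>" using f\<tau> finite_subset by blast
        then have "card (insert u \<sigma>) \<le> d + 1" "insert u \<sigma> \<subseteq> \<tau>" "u \<notin> \<sigma>"
          using \<sigma> u by (auto simp: card_insert_if)
        then have "indep (insert u \<sigma>)" "u \<notin> \<sigma>" using \<tau> by (auto simp: gp_complex_def)
        moreover have "(\<Sum>v\<in>S. of_bool (mat_cl V indep (insert u \<sigma>) = mat_cl V indep (insert v \<sigma>)) * f v)
            = (\<Sum>v | v \<in> S \<and> mat_cl V indep (insert v \<sigma>) = mat_cl V indep (insert u \<sigma>). f v)"
          using fS by (intro sum.mono_neutral_cong_right) auto
        ultimately show "(\<Sum>v\<in>S. of_bool (mat_cl V indep (insert u \<sigma>) = mat_cl V indep (insert v \<sigma>)) * f v) \<le> real d"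
          using flag[of \<sigma> u] \<sigma> u \<tau> by auto
      qed
      also have "\<dots> = real d * real (\<Sum>j<d. (n - 1) choose j)"
        using card_small_subsets[of "\<tau> - {u}" d] f\<tau> u \<tau> by simp
      finally show "(\<Sum>v\<in>S. agree d (\<tau> - {u}) u v * f v) \<le> real d * real (\<Sum>j<d. (n - 1) choose j)" .
    qed
    also have "\<dots> = \<beta>" unfolding \<beta>_def weighted_binomial_sum using \<tau> by simp
    also note sumS
    finally show "sum f (nonext \<tau>) + (\<Sum>u\<in>\<tau>. \<Sum>v\<in>ext (\<tau> - {u}).
          (agree d (\<tau> - {u}) u v - clash (\<tau> - {u}) u v) * f v) < sum f S" .
  qed
qed

end

section \<open>Colourful sets in general position\<close>

lemma bdry_restrict:
  assumes "finite V" "S \<subseteq> V" "\<And>\<tau>. c \<tau> \<noteq> 0 \<Longrightarrow> \<tau> \<subseteq> S"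
  shows "bdry key V c = bdry key S c"
proof
  fix \<rho>
  show "bdry key V c \<rho> = bdry key S c \<rho>"
    unfolding bdry_def
    by (rule sum.mono_neutral_right) (use assms in auto)
qed

theorem theorem1p9:
  fixes V :: "'a set" and indep :: "'a set \<Rightarrow> bool"
    and d m :: nat and P :: "nat \<Rightarrow> 'a set"
  assumes "1 \<le> d"
    and "matroid V indep"
    and "loopless V indep"
    and "mat_rank indep V = d + 1"
    and "disjoint_family_on P {1..m}"
    and "(\<Union>i\<in>{1..m}. P i) = V"
    and "\<And>I. I \<subseteq> {1..m} \<Longrightarrow> I \<noteq> {} \<Longrightarrow>
           phi_star V indep d (\<Union>i\<in>I. P i)
             > real d * (\<Sum>r=1..d. real r * real ((card I - 1) choose r))"
  shows "\<exists>\<sigma>. \<sigma> \<subseteq> V \<and> general_position V indep d \<sigma> \<and> (\<forall>i\<in>{1..m}. card (\<sigma> \<inter> P i) = 1)"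
proof -
  interpret matroid V indep by fact
  define col where "col v = (THE i. i \<in> {1..m} \<and> v \<in> P i)" for v
  have col_eq: "col v = i" if "i \<in> {1..m}" "v \<in> P i" for v i
    unfolding col_def
  proof (rule the_equality)
    show "k = i" if "k \<in> {1..m} \<and> v \<in> P k" for k
      using that \<open>i \<in> {1..m}\<close> \<open>v \<in> P i\<close> assms(5) unfolding disjoint_family_on_def by blast
  qed (use that in simp)
  have col: "v \<in> P i \<longleftrightarrow> col v = i" if "v \<in> V" "i \<in> {1..m}" for v i
    using col_eq that assms(6) by blast
  obtain idx :: "'a \<Rightarrow> nat" and N where idx: "inj_on idx V" "idx ` V = {i. i < N}"
    using finite_imp_inj_to_nat_seg[OF finite_ground] by metis
  \<comment> \<open>A linear order of the vertices that sorts by colour first.\<close>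
  define key where "key v = col v * N + idx v" for v
  have idxN: "idx v < N" if "v \<in> V" for v using idx that by auto
  have mono: "key u < key v" if "u \<in> V" "v \<in> V" "col u < col v" for u v
  proof -
    have "key u < (col u + 1) * N" using idxN[OF that(1)] by (simp add: key_def)
    also have "\<dots> \<le> col v * N" using that(3) by (intro mult_right_mono) auto
    finally show ?thesis by (simp add: key_def)
  qed
  have inj: "inj_on key V"
  proof (rule inj_onI)
    fix u v assume *: "u \<in> V" "v \<in> V" "key u = key v"
    then have "col u = col v" using mono by (metis less_irrefl linorder_neqE_nat)
    then show "u = v" using * idx(1) by (auto simp: key_def dest: inj_onD)
  qed
  have "\<exists>\<tau>\<in>gp_complex d. bij_betw col \<tau> {1..m}"
  proof (rule rainbow_face_exists[OF finite_ground _ inj mono])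
    show "{} \<in> gp_complex d" using indep_empty by (simp add: gp_complex_def)
    fix I z assume I: "I \<subseteq> {1..m}" "I \<noteq> {}"
      and z: "chain {\<tau> \<in> gp_complex d. col ` \<tau> \<subseteq> I} (card I - 1) z" "\<And>\<rho>. bdry key V z \<rho> = 0"
    define S where "S = (\<Union>i\<in>I. P i)"
    have S: "S \<subseteq> V" using I assms(6) by (auto simp: S_def)
    have "col ` \<tau> \<subseteq> I \<longleftrightarrow> \<tau> \<subseteq> S" if "\<tau> \<subseteq> V" for \<tau>
    proof -
      have "col v \<in> I \<longleftrightarrow> v \<in> S" if v: "v \<in> V" for v
      proof
        assume "col v \<in> I"
        then show "v \<in> S" using col[OF v, of "col v"] I by (auto simp: S_def)
      next
        assume "v \<in> S"
        then obtain i where "i \<in> I" "v \<in> P i" by (auto simp: S_def)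
        then show "col v \<in> I" using col_eq I by blast
      qed
      then show ?thesis using that by blast
    qed
    then have X: "{\<tau> \<in> gp_complex d. col ` \<tau> \<subseteq> I} = {\<tau> \<in> gp_complex d. \<tau> \<subseteq> S}" by (auto simp: gp_complex_def)
    have restrict: "bdry key V c = bdry key S c" if "chain {\<tau> \<in> gp_complex d. \<tau> \<subseteq> S} k c" for c k
      using that by (intro bdry_restrict[OF finite_ground S]) (auto simp: chain_def)
    obtain f where f: "fractional_general_position V indep d S f" "sum f S = phi_star V indep d S"
      using phi_star_is_maximum(1)[OF assms(3,1) S] by blast
    have "finite I" using I finite_subset by blast
    then have "Suc (card I - 1) = card I" using I by (simp add: card_gt_0_iff)
    moreover have "\<exists>y. chain {\<tau> \<in> gp_complex d. \<tau> \<subseteq> S} (Suc (card I - 1)) y \<and> bdry key S y = z"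
      using cycle_bounds_of_fractional[OF assms(3,1) S inj_on_subset[OF inj S] f(1), of "card I - 1" z]
        assms(7)[OF I] f(2) z restrict unfolding X S_def[symmetric] by simp
    ultimately show "\<exists>y. chain {\<tau> \<in> gp_complex d. col ` \<tau> \<subseteq> I} (card I) y \<and> bdry key V y = z"
      unfolding X using restrict by metis
  qed simp_all
  then obtain \<tau> where \<tau>: "\<tau> \<in> gp_complex d" "bij_betw col \<tau> {1..m}" by blast
  have "card (\<tau> \<inter> P i) = 1" if i: "i \<in> {1..m}" for i
  proof -
    obtain v where v: "v \<in> \<tau>" "col v = i" using \<tau>(2) i unfolding bij_betw_def by (metis imageE)
    have "\<tau> \<inter> P i = {v}"
    proof (intro equalityI subsetI)
      fix w assume "w \<in> \<tau> \<inter> P i"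
      then have "w \<in> \<tau>" "col w = col v" using col_eq[OF i] v by auto
      then show "w \<in> {v}" using \<tau>(2) v(1) unfolding bij_betw_def by (auto dest: inj_onD)
    next
      fix w assume "w \<in> {v}"
      moreover have "v \<in> V" using v \<tau>(1) by (auto simp: gp_complex_def)
      ultimately show "w \<in> \<tau> \<inter> P i" using v col[OF _ i] by blast
    qed
    then show ?thesis by simp
  qed
  then show ?thesis using \<tau>(1) gp_complex_general_position by (intro exI[of _ \<tau>]) (auto simp: gp_complex_def)
qed

end
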